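(* Let $\mathcal{H}=\{H_1,\dots,H_l\}$ be a finite collection of stable subgroups of a finitely generated group $G$. For each $D\ge0$ there exists $R\ge0$ such that if $\mathcal{C}$ is a collection of pairwise $D$-close left cosets of subgroups in $\mathcal{H}$, then there is an $x\in G$ such that $$N_R(x)\cap gH_i\neq\emptyset$$ for each $gH_i\in\mathcal{C}$.
   Context: $G$ carries the word metric of a fixed finite generating set, and $N_R(x)$ is the ball of radius $R$ around $x$. Two cosets are $D$-close if the minimum distance between them is at most $D$. Stability. Let $X$ be a geodesic metric space and $f\colon \mathbb{R}_{\ge 1}\times\mathbb{R}_{\ge 0}\to\mathbb{R}_{\ge 0}$. A quasigeodesic $\gamma$ in $X$ is $f$-stable if every $(K,\epsilon)$-quasigeodesic with endpoints on $\gamma$ is contained in the $f(K,\epsilon)$-neighborhood of $\gamma$. If $H\le G$ are finitely generated groups (viewed via Cayley graphs with respect to finite generating sets), $H$ is a stable subgroup of $G$ if the inclusion is a quasi-isometric embedding and there is a single $f$ such that the image of every geodesic of $H$ is an $f$-stable quasigeodesic in $G$. *)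

theory Defs
  imports "HOL-Analysis.Analysis" "HOL-Algebra.Generated_Groups"
begin

section \<open>Word metrics\<close>

definition finite_generating_set :: "('a, 'b) monoid_scheme \<Rightarrow> 'a set \<Rightarrow> bool" where
  "finite_generating_set G S \<longleftrightarrow> finite S \<and> S \<subseteq> carrier G \<and> generate G S = carrier G"

definition word_length :: "('a, 'b) monoid_scheme \<Rightarrow> 'a set \<Rightarrow> 'a \<Rightarrow> nat" where
  "word_length G S g =
     (LEAST n. \<exists>ws. set ws \<subseteq> S \<union> m_inv G ` S \<and> length ws = n \<and>
                    foldr (\<otimes>\<^bsub>G\<^esub>) ws \<one>\<^bsub>G\<^esub> = g)"

definition word_dist :: "('a, 'b) monoid_scheme \<Rightarrow> 'a set \<Rightarrow> 'a \<Rightarrow> 'a \<Rightarrow> nat" where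
  "word_dist G S x y = word_length G S (inv\<^bsub>G\<^esub> x \<otimes>\<^bsub>G\<^esub> y)"

definition word_ball :: "('a, 'b) monoid_scheme \<Rightarrow> 'a set \<Rightarrow> real \<Rightarrow> 'a \<Rightarrow> 'a set" where
  "word_ball G S R x = {y \<in> carrier G. real (word_dist G S x y) \<le> R}"

definition min_dist :: "('a, 'b) monoid_scheme \<Rightarrow> 'a set \<Rightarrow> 'a set \<Rightarrow> 'a set \<Rightarrow> nat" where
  "min_dist G S A B = (LEAST n. \<exists>a\<in>A. \<exists>b\<in>B. n = word_dist G S a b)"

definition close :: "('a, 'b) monoid_scheme \<Rightarrow> 'a set \<Rightarrow> real \<Rightarrow> 'a set \<Rightarrow> 'a set \<Rightarrow> bool" where
  "close G S D A B \<longleftrightarrow> real (min_dist G S A B) \<le> D"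

section \<open>Cayley graphs as geodesic metric spaces\<close>

text \<open>
  The Cayley graph is the geometric realization of the simple graph on \<^term>\<open>carrier G\<close> that joins
  \<open>u\<close> and \<open>v\<close> when their word distance is 1. Its points are written in barycentric coordinates:
  \<open>edge_point u v t\<close> is the point at distance \<open>t\<close> from \<open>u\<close> on the edge from \<open>u\<close> to \<open>v\<close>, that is,
  the function with value \<open>1 - t\<close> at \<open>u\<close>, value \<open>t\<close> at \<open>v\<close>, and 0 elsewhere.
  The vertex \<open>v\<close> is the case \<open>u = v\<close>.
\<close>

definition edge_point :: "'a \<Rightarrow> 'a \<Rightarrow> real \<Rightarrow> ('a \<Rightarrow> real)" where
  "edge_point u v t = (\<lambda>w. (1 - t) * of_bool (w = u) + t * of_bool (w = v))"

definition vertex :: "'a \<Rightarrow> ('a \<Rightarrow> real)" where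
  "vertex v = (\<lambda>w. of_bool (w = v))"

definition cayley_graph :: "('a, 'b) monoid_scheme \<Rightarrow> 'a set \<Rightarrow> ('a \<Rightarrow> real) set" where
  "cayley_graph G S =
     {edge_point u v t | u v t.
        u \<in> carrier G \<and> v \<in> carrier G \<and> word_dist G S u v \<le> 1 \<and> 0 \<le> t \<and> t \<le> 1}"

text \<open>
  The path metric with all edges of length 1. A shortest path from \<open>p\<close> to \<open>q\<close> either stays in an
  edge (or vertex) containing both points, or leaves the edge of \<open>p\<close> at an endpoint \<open>u\<close>, which is
  at distance \<open>1 - p u\<close> from \<open>p\<close>, and enters the edge of \<open>q\<close> at an endpoint \<open>v\<close>.
\<close>

definition cayley_dist ::
    "('a, 'b) monoid_scheme \<Rightarrow> 'a set \<Rightarrow> ('a \<Rightarrow> real) \<Rightarrow> ('a \<Rightarrow> real) \<Rightarrow> real" where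
  "cayley_dist G S p q =
     Inf ({\<bar>p u - q u\<bar> | u v. u \<in> carrier G \<and> v \<in> carrier G \<and> word_dist G S u v \<le> 1 \<and>
             {w. p w \<noteq> 0} \<union> {w. q w \<noteq> 0} \<subseteq> {u, v}} \<union>
          {(1 - p u) + real (word_dist G S u v) + (1 - q v) | u v. p u \<noteq> 0 \<and> q v \<noteq> 0})"

section \<open>Quasigeodesics and stability\<close>

definition qi_embedding ::
    "'x set \<Rightarrow> ('x \<Rightarrow> 'x \<Rightarrow> real) \<Rightarrow> 'y set \<Rightarrow> ('y \<Rightarrow> 'y \<Rightarrow> real) \<Rightarrow> real \<Rightarrow> real \<Rightarrow> ('x \<Rightarrow> 'y) \<Rightarrow> bool"
  where
  "qi_embedding X dX Y dY K \<epsilon> \<phi> \<longleftrightarrow>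
     \<phi> \<in> X \<rightarrow> Y \<and>
     (\<forall>x\<in>X. \<forall>x'\<in>X. dX x x' / K - \<epsilon> \<le> dY (\<phi> x) (\<phi> x') \<and> dY (\<phi> x) (\<phi> x') \<le> K * dX x x' + \<epsilon>)"

definition quasigeodesic ::
    "'x set \<Rightarrow> ('x \<Rightarrow> 'x \<Rightarrow> real) \<Rightarrow> real \<Rightarrow> real \<Rightarrow> real set \<Rightarrow> (real \<Rightarrow> 'x) \<Rightarrow> bool" where
  "quasigeodesic X d K \<epsilon> I \<gamma> \<longleftrightarrow> is_interval I \<and> qi_embedding I dist X d K \<epsilon> \<gamma>"

definition geodesic ::
    "'x set \<Rightarrow> ('x \<Rightarrow> 'x \<Rightarrow> real) \<Rightarrow> real set \<Rightarrow> (real \<Rightarrow> 'x) \<Rightarrow> bool" where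
  "geodesic X d I \<gamma> \<longleftrightarrow>
     is_interval I \<and> \<gamma> \<in> I \<rightarrow> X \<and> (\<forall>s\<in>I. \<forall>t\<in>I. d (\<gamma> s) (\<gamma> t) = dist s t)"

definition stable_quasigeodesic ::
    "'x set \<Rightarrow> ('x \<Rightarrow> 'x \<Rightarrow> real) \<Rightarrow> (real \<Rightarrow> real \<Rightarrow> real) \<Rightarrow> real set \<Rightarrow> (real \<Rightarrow> 'x) \<Rightarrow> bool" where
  "stable_quasigeodesic X d f I \<gamma> \<longleftrightarrow>
     (\<exists>K\<ge>1. \<exists>\<epsilon>\<ge>0. quasigeodesic X d K \<epsilon> I \<gamma>) \<and>
     (\<forall>K\<ge>1. \<forall>\<epsilon>\<ge>0. \<forall>a b \<eta>.
        a \<le> b \<and> quasigeodesic X d K \<epsilon> {a..b} \<eta> \<and> \<eta> a \<in> \<gamma> ` I \<and> \<eta> b \<in> \<gamma> ` I \<longrightarrow>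
        (\<forall>s\<in>{a..b}. \<exists>t\<in>I. d (\<eta> s) (\<gamma> t) \<le> f K \<epsilon>))"

text \<open>
  Here \<open>\<phi>\<close> is the inclusion of \<open>H\<close> into \<open>G\<close>, extended over the edges of the Cayley graph of \<open>H\<close>.
  Any two quasi-isometric embeddings that restrict to the inclusion on vertices are at
  bounded distance from each other, so the choice of extension is immaterial (it only changes \<open>f\<close>).
\<close>

definition stable_subgroup :: "('a, 'b) monoid_scheme \<Rightarrow> 'a set \<Rightarrow> 'a set \<Rightarrow> bool" where
  "stable_subgroup G S H \<longleftrightarrow>
     subgroup H G \<and>
     (\<exists>T \<phi> f.
        finite_generating_set (G\<lparr>carrier := H\<rparr>) T \<and>
        (\<forall>h\<in>H. \<phi> (vertex h) = vertex h) \<and>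
        (\<exists>K\<ge>1. \<exists>\<epsilon>\<ge>0. qi_embedding
           (cayley_graph (G\<lparr>carrier := H\<rparr>) T) (cayley_dist (G\<lparr>carrier := H\<rparr>) T)
           (cayley_graph G S) (cayley_dist G S) K \<epsilon> \<phi>) \<and>
        (\<forall>K\<ge>1. \<forall>\<epsilon>\<ge>0. f K \<epsilon> \<ge> 0) \<and>
        (\<forall>I \<gamma>. geodesic (cayley_graph (G\<lparr>carrier := H\<rparr>) T) (cayley_dist (G\<lparr>carrier := H\<rparr>) T) I \<gamma> \<longrightarrow>
           stable_quasigeodesic (cayley_graph G S) (cayley_dist G S) f I (\<phi> \<circ> \<gamma>)))"

end

theory Submission
  imports Defs
begin

text \<open>
  A subset of a metric space is \<^emph>\<open>Morse\<close> if quasigeodesics with endpoints on it stay near it. Stability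
  says that the geodesics of \<open>H\<close> are uniformly Morse in \<open>G\<close>; in particular each coset \<open>gH\<close>
  is Morse, with one gauge for all \<open>g\<close> and all of the finitely many \<open>H\<close>.

  The elementary observation behind everything is that, if \<open>c\<close> is a point of a geodesic nearest to
  \<open>r\<close>, then a geodesic from \<open>r\<close> to \<open>c\<close> followed by either half of the given geodesic is a
  quasigeodesic. Hence, for three Morse sets that pairwise come close to each other, the point of a
  geodesic joining two of the three meeting points that is nearest to the third one is near all
  three sets (\<open>common_center\<close>). Applied to the sides of a triangle of geodesics in a coset \<open>A\<close>,
  this says that \<open>A\<close> with its own word metric has centers for triangles, so it behaves like a
  hyperbolic space; applied to \<open>A\<close> and two other cosets, it says that the shadows on \<open>A\<close> of cosets
  that are pairwise close are again pairwise close.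

  The coarse Helly property of hyperbolic spaces now applies to these shadows. Fix a base
  point \<open>z\<close> in \<open>A\<close>, choose in each shadow a point that is nearest to \<open>z\<close>, and among these
  points take one that is farthest from \<open>z\<close>. For any other coset \<open>C\<close>, a geodesic of \<open>A\<close> from \<open>z\<close> to a
  common point \<open>q\<close> of the two shadows passes near both nearest points; the farthest one comes later
  (up to a constant), so it lies near the part of the geodesic between the nearest point of \<open>C\<close> and
  \<open>q\<close>, and that part stays near \<open>C\<close> because \<open>C\<close> is Morse (\<open>coarse_helly\<close>).

  The farthest point exists only for a finite family, but the resulting radius \<open>R\<close> does not depend on the
  number of cosets. A ball of radius \<open>R\<close> meets at most \<open>|B(R)| * |\<H>|\<close> cosets, so the radius bounds the
  size of every finite subfamily, and therefore a collection of pairwise close cosets is always finite.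
\<close>

section \<open>Discrete quasigeodesics and Morse sets\<close>

definition discrete_geodesic :: "'x set \<Rightarrow> ('x \<Rightarrow> 'x \<Rightarrow> real) \<Rightarrow> nat \<Rightarrow> (nat \<Rightarrow> 'x) \<Rightarrow> bool" where
  "discrete_geodesic X d n w \<longleftrightarrow>
     w \<in> {..n} \<rightarrow> X \<and> (\<forall>i\<le>n. \<forall>j\<le>n. d (w i) (w j) = \<bar>real i - real j\<bar>)"

text \<open>
  One constant plays both roles of the usual pair \<open>(K, \<epsilon>)\<close>, and paths are sampled at integer
  times. Since quasigeodesics may jump, such a sample carries the same information.
\<close>
definition discrete_quasigeodesic ::
    "'x set \<Rightarrow> ('x \<Rightarrow> 'x \<Rightarrow> real) \<Rightarrow> real \<Rightarrow> nat \<Rightarrow> (nat \<Rightarrow> 'x) \<Rightarrow> bool" where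
  "discrete_quasigeodesic X d L n w \<longleftrightarrow>
     w \<in> {..n} \<rightarrow> X \<and>
     (\<forall>i\<le>n. \<forall>j\<le>n. \<bar>real i - real j\<bar> / L - L \<le> d (w i) (w j) \<and>
                    d (w i) (w j) \<le> L * \<bar>real i - real j\<bar> + L)"

definition discretely_geodesic :: "'x set \<Rightarrow> ('x \<Rightarrow> 'x \<Rightarrow> real) \<Rightarrow> bool" where
  "discretely_geodesic X d \<longleftrightarrow>
     (\<forall>x\<in>X. \<forall>y\<in>X. \<exists>n w. discrete_geodesic X d n w \<and> w 0 = x \<and> w n = y)"

text \<open>
  A pointwise form of closed neighbourhoods that asks for a witness, so that it does not rely on an
  infimum being attained.
\<close>
definition near :: "('x \<Rightarrow> 'x \<Rightarrow> real) \<Rightarrow> real \<Rightarrow> 'x set \<Rightarrow> 'x \<Rightarrow> bool" where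
  "near d r P x \<longleftrightarrow> (\<exists>p\<in>P. d x p \<le> r)"

definition morse :: "'x set \<Rightarrow> ('x \<Rightarrow> 'x \<Rightarrow> real) \<Rightarrow> (real \<Rightarrow> real) \<Rightarrow> 'x set \<Rightarrow> bool" where
  "morse X d \<mu> P \<longleftrightarrow>
     P \<subseteq> X \<and>
     (\<forall>L\<ge>1. \<forall>n \<eta>. discrete_quasigeodesic X d L n \<eta> \<and> \<eta> 0 \<in> P \<and> \<eta> n \<in> P \<longrightarrow>
        (\<forall>i\<le>n. near d (\<mu> L) P (\<eta> i)))"

text \<open>
  The metric content of a stable subgroup or of one of its cosets \<open>A\<close>, whose own word metric is \<open>dA\<close>.
  The second bound is the lower quasi-isometry inequality solved for \<open>dA\<close>. The Morse
  condition concerns each geodesic of \<open>A\<close> and not only \<open>A\<close>: this is what provides centers for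
  triangles in \<open>A\<close>.
\<close>
definition stably_embedded ::
    "'x set \<Rightarrow> ('x \<Rightarrow> 'x \<Rightarrow> real) \<Rightarrow> real \<Rightarrow> (real \<Rightarrow> real) \<Rightarrow> 'x set \<Rightarrow> ('x \<Rightarrow> 'x \<Rightarrow> real) \<Rightarrow> bool" where
  "stably_embedded X d K \<mu> A dA \<longleftrightarrow>
     A \<subseteq> X \<and> Metric_space A dA \<and> discretely_geodesic A dA \<and>
     (\<forall>x\<in>A. \<forall>y\<in>A. d x y \<le> K * dA x y + K \<and> dA x y \<le> K * d x y + K) \<and>
     (\<forall>n w. discrete_geodesic A dA n w \<longrightarrow> morse X d \<mu> (w ` {..n}))"

lemma near_mono: "near d r P x \<Longrightarrow> r \<le> s \<Longrightarrow> P \<subseteq> Q \<Longrightarrow> near d s Q x"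
  unfolding near_def by force

lemma discrete_geodesicD:
  assumes "discrete_geodesic X d n w" "i \<le> n" "j \<le> n"
  shows "d (w i) (w j) = \<bar>real i - real j\<bar>" "w i \<in> X"
  using assms unfolding discrete_geodesic_def by auto

lemma discrete_geodesic_segment:
  assumes "discrete_geodesic X d n w" "k \<le> n"
  shows "discrete_geodesic X d (n - k) (\<lambda>i. w (k + i))"
  using assms unfolding discrete_geodesic_def by (auto simp: Pi_iff)

lemma discrete_geodesic_reverse:
  assumes "discrete_geodesic X d n w" "k \<le> n"
  shows "discrete_geodesic X d k (\<lambda>i. w (k - i))"
  using assms unfolding discrete_geodesic_def by (auto simp: Pi_iff of_nat_diff)

lemma morse_mono: "morse X d \<mu> P \<Longrightarrow> (\<And>L. L \<ge> 1 \<Longrightarrow> \<mu> L \<le> \<nu> L) \<Longrightarrow> morse X d \<nu> P"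
  unfolding morse_def by (meson near_mono order_refl)

text \<open>
  The two values of \<open>\<mu>\<close> are for geodesics (constant 1) and for a shortest path to a geodesic that then
  follows this geodesic (constant 3), with endpoints at distance at most \<open>D\<close> from the Morse set.
\<close>
definition center_radius :: "(real \<Rightarrow> real) \<Rightarrow> real \<Rightarrow> real" where
  "center_radius \<mu> D = max (\<mu> (1 + 2 * D)) (\<mu> (3 + 2 * D)) + D"

context Metric_space
begin

lemma near_triangle:
  assumes "near d r P y" "d x y \<le> s" "x \<in> M" "y \<in> M" "P \<subseteq> M"
  shows "near d (r + s) P x"
proof -
  obtain p where p: "p \<in> P" "d y p \<le> r"
    using assms unfolding near_def by blast
  then show ?thesis
    using triangle[of x y p] assms unfolding near_def by (intro bexI[of _ p]) auto
qed

lemma near_self: "x \<in> P \<Longrightarrow> P \<subseteq> M \<Longrightarrow> 0 \<le> r \<Longrightarrow> near d r P x"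
  unfolding near_def by (intro bexI[of _ x]) auto

lemma discrete_quasigeodesic_perturb:
  assumes \<eta>: "discrete_quasigeodesic M d L n \<eta>" and L: "L \<ge> 1" and D: "D \<ge> 0"
    and \<eta>': "\<And>i. i \<le> n \<Longrightarrow> \<eta>' i \<in> M \<and> d (\<eta> i) (\<eta>' i) \<le> D"
  shows "discrete_quasigeodesic M d (L + 2 * D) n \<eta>'"
  unfolding discrete_quasigeodesic_def
proof (intro conjI allI impI)
  show "\<eta>' \<in> {..n} \<rightarrow> M" using \<eta>' by auto
  fix i j assume ij: "i \<le> n" "j \<le> n"
  let ?r = "\<bar>real i - real j\<bar>"
  have mem: "\<eta> i \<in> M" "\<eta> j \<in> M" and bd: "?r / L - L \<le> d (\<eta> i) (\<eta> j)" "d (\<eta> i) (\<eta> j) \<le> L * ?r + L"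
    using \<eta> ij unfolding discrete_quasigeodesic_def by auto
  have D': "\<bar>d (\<eta>' i) (\<eta>' j) - d (\<eta> i) (\<eta> j)\<bar> \<le> 2 * D"
    using mem \<eta>'[OF ij(1)] \<eta>'[OF ij(2)] triangle[of "\<eta>' i" "\<eta> i" "\<eta>' j"] triangle[of "\<eta> i" "\<eta> j" "\<eta>' j"]
      triangle[of "\<eta> i" "\<eta>' i" "\<eta> j"] triangle[of "\<eta>' i" "\<eta>' j" "\<eta> j"]
      commute[of "\<eta> i" "\<eta>' i"] commute[of "\<eta> j" "\<eta>' j"] by linarith
  have "?r / (L + 2 * D) \<le> ?r / L" using L D by (intro divide_left_mono) auto
  then show "?r / (L + 2 * D) - (L + 2 * D) \<le> d (\<eta>' i) (\<eta>' j)" using bd D' by linarith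
  have "L * ?r \<le> (L + 2 * D) * ?r" using D by (intro mult_right_mono) auto
  then show "d (\<eta>' i) (\<eta>' j) \<le> (L + 2 * D) * ?r + (L + 2 * D)" using bd D' by linarith
qed

text \<open>
  Since quasigeodesics need not be continuous, endpoints that are only near the Morse set may simply be
  moved onto it, at the cost of a larger constant.
\<close>
lemma morse_near_endpoints:
  assumes P: "morse M d \<mu> P" and \<eta>: "discrete_quasigeodesic M d L n \<eta>" and L: "L \<ge> 1" and D: "D \<ge> 0"
    and ends: "near d D P (\<eta> 0)" "near d D P (\<eta> n)" and i: "i \<le> n"
  shows "near d (\<mu> (L + 2 * D) + D) P (\<eta> i)"
proof -
  obtain p q where pq: "p \<in> P" "q \<in> P" "d (\<eta> 0) p \<le> D" "d (\<eta> n) q \<le> D"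
    using ends unfolding near_def by blast
  have PM: "P \<subseteq> M" using P unfolding morse_def by blast
  have \<eta>M: "\<eta> j \<in> M" if "j \<le> n" for j using \<eta> that unfolding discrete_quasigeodesic_def by auto
  \<comment> \<open>The case \<open>n = 0\<close> is included: then both ends are moved to \<open>p\<close>.\<close>
  define \<eta>' where "\<eta>' j = (if j = 0 then p else if j = n then q else \<eta> j)" for j
  have close: "\<eta>' j \<in> M \<and> d (\<eta> j) (\<eta>' j) \<le> D" if "j \<le> n" for j
    using that pq PM \<eta>M D unfolding \<eta>'_def by auto
  have "discrete_quasigeodesic M d (L + 2 * D) n \<eta>'"
    by (rule discrete_quasigeodesic_perturb[OF \<eta> L D close])
  moreover have "\<eta>' 0 \<in> P" "\<eta>' n \<in> P" using pq unfolding \<eta>'_def by auto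
  ultimately have "near d (\<mu> (L + 2 * D)) P (\<eta>' i)"
    using P L D i unfolding morse_def by (metis add_increasing2 mult_nonneg_nonneg zero_le_numeral)
  then show ?thesis
    by (rule near_triangle) (use close[OF i] \<eta>M[OF i] PM in auto)
qed

lemma geodesic_imp_quasigeodesic:
  assumes "discrete_geodesic M d n w"
  shows "discrete_quasigeodesic M d 1 n w"
  using assms unfolding discrete_geodesic_def discrete_quasigeodesic_def by auto

text \<open>
  If \<open>p\<close> lies before the corner \<open>c\<close> and \<open>p'\<close> after it, then \<open>d p c \<le> d p p'\<close> because \<open>c\<close> is nearest to the
  starting point, and so \<open>d c p' \<le> 2 * d p p'\<close>. The length \<open>d p c + d c p'\<close> of the path is
  therefore at most three times the distance.
\<close>
lemma nearest_point_concat: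
  assumes v: "discrete_geodesic M d m v" and u: "discrete_geodesic M d l u" and c: "v m = u 0"
    and nearest: "\<And>j. j \<le> l \<Longrightarrow> d (v 0) (u 0) \<le> d (v 0) (u j)"
  shows "discrete_quasigeodesic M d 3 (m + l) (\<lambda>i. if i \<le> m then v i else u (i - m))"
proof -
  define \<eta> where "\<eta> i = (if i \<le> m then v i else u (i - m))" for i
  have \<eta>M: "\<eta> i \<in> M" if "i \<le> m + l" for i
    using v u that unfolding \<eta>_def discrete_geodesic_def by (auto simp: Pi_iff)
  have main: "real j - real i \<le> 3 * d (\<eta> i) (\<eta> j) \<and> d (\<eta> i) (\<eta> j) \<le> real j - real i"
    if ij: "i \<le> j" "j \<le> m + l" for i j
  proof -
    consider "j \<le> m" | "i > m" | "i \<le> m" "j > m" by linarith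
    then show ?thesis
    proof cases
      case 1
      then show ?thesis using ij discrete_geodesicD(1)[OF v, of i j] unfolding \<eta>_def by auto
    next
      case 2
      then show ?thesis using ij discrete_geodesicD(1)[OF u, of "i - m" "j - m"] unfolding \<eta>_def
        by (auto simp: of_nat_diff)
    next
      case 3
      let ?j = "j - m"
      have j: "?j \<le> l" "real ?j = real j - real m" using 3 ij by auto
      have mem: "v 0 \<in> M" "v i \<in> M" "u 0 \<in> M" "u ?j \<in> M"
        using discrete_geodesicD(2)[OF v, of 0] discrete_geodesicD(2)[OF v, of i]
          discrete_geodesicD(2)[OF u, of 0] discrete_geodesicD(2)[OF u, of ?j] 3 j by auto
      have e: "d (v 0) (u 0) = m" "d (v 0) (v i) = i" "d (v i) (u 0) = real m - real i"
        "d (u 0) (u ?j) = real j - real m"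
        using discrete_geodesicD(1)[OF v, of 0 m] discrete_geodesicD(1)[OF v, of 0 i]
          discrete_geodesicD(1)[OF v, of i m] discrete_geodesicD(1)[OF u, of 0 ?j] 3 j c by auto
      show ?thesis
        using triangle[of "v 0" "v i" "u ?j"] triangle[of "u 0" "v i" "u ?j"] triangle[of "v i" "u 0" "u ?j"]
          mem e nearest[OF j(1)] commute[of "u 0" "v i"] 3 unfolding \<eta>_def by simp
    qed
  qed
  have "\<bar>real i - real j\<bar> / 3 - 3 \<le> d (\<eta> i) (\<eta> j) \<and> d (\<eta> i) (\<eta> j) \<le> 3 * \<bar>real i - real j\<bar> + 3"
    if "i \<le> m + l" "j \<le> m + l" for i j
    using main[of i j] main[of j i] that commute[of "\<eta> i" "\<eta> j"] nonneg[of "\<eta> i" "\<eta> j"]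
    by (cases "i \<le> j") (auto simp: field_simps)
  then show ?thesis unfolding discrete_quasigeodesic_def \<eta>_def[symmetric] using \<eta>M by auto
qed

lemma nearest_point_near_morse:
  assumes geo: "discretely_geodesic M d" and r: "r \<in> M" and u: "discrete_geodesic M d l u"
    and nearest: "\<And>j. j \<le> l \<Longrightarrow> d r (u 0) \<le> d r (u j)"
    and P: "morse M d \<mu> P" and D: "D \<ge> 0" "near d D P r" "near d D P (u l)"
  shows "near d (center_radius \<mu> D) P (u 0)"
proof -
  obtain m v where v: "discrete_geodesic M d m v" "v 0 = r" "v m = u 0"
    using geo r discrete_geodesicD(2)[OF u, of 0] unfolding discretely_geodesic_def by (meson le0)
  let ?\<eta> = "\<lambda>i. if i \<le> m then v i else u (i - m)"
  have "discrete_quasigeodesic M d 3 (m + l) ?\<eta>"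
    using nearest v by (intro nearest_point_concat[OF v(1) u]) auto
  then have "near d (\<mu> (3 + 2 * D) + D) P (?\<eta> m)"
  proof (rule morse_near_endpoints[OF P])
    show "near d D P (?\<eta> (m + l))" using D v by (cases "l = 0") auto
  qed (use D v in auto)
  then show ?thesis using v by (auto simp: center_radius_def elim!: near_mono)
qed

text \<open>
  Two sides \<open>P\<close> and \<open>Q\<close> of a triangle are Morse, the third one is the geodesic \<open>w\<close>: its point nearest to the
  opposite vertex \<open>r\<close> lies on quasigeodesics that join the endpoints of either side.
\<close>
lemma triangle_center:
  assumes geo: "discretely_geodesic M d" and r: "r \<in> M" and w: "discrete_geodesic M d n w"
    and P: "morse M d \<mu> P" "near d D P (w 0)" "near d D P r"
    and Q: "morse M d \<mu> Q" "near d D Q (w n)" "near d D Q r" and D: "D \<ge> 0"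
  shows "\<exists>k\<le>n. near d (center_radius \<mu> D) P (w k) \<and> near d (center_radius \<mu> D) Q (w k)"
proof -
  obtain k where k: "k \<in> {..n}" "\<And>j. j \<in> {..n} \<Longrightarrow> d r (w k) \<le> d r (w j)"
    using ex_is_arg_min_if_finite[of "{..n}" "\<lambda>j. d r (w j)"]
    by (auto simp: is_arg_min_linorder)
  have "near d (center_radius \<mu> D) P ((\<lambda>i. w (k - i)) 0)"
    by (rule nearest_point_near_morse[OF geo r discrete_geodesic_reverse[OF w, of k]])
      (use k P D in auto)
  moreover have "near d (center_radius \<mu> D) Q ((\<lambda>i. w (k + i)) 0)"
    by (rule nearest_point_near_morse[OF geo r discrete_geodesic_segment[OF w, of k]])
      (use k Q D in auto)
  ultimately show ?thesis using k by auto
qed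

lemma stably_embedded_imp_morse:
  assumes "stably_embedded M d K \<mu> A dA"
  shows "morse M d \<mu> A"
  unfolding morse_def
proof (intro conjI allI impI)
  show "A \<subseteq> M" using assms unfolding stably_embedded_def by blast
  fix L :: real and n \<eta> i
  assume L: "L \<ge> 1" and \<eta>: "discrete_quasigeodesic M d L n \<eta> \<and> \<eta> 0 \<in> A \<and> \<eta> n \<in> A" and i: "i \<le> n"
  obtain k w where w: "discrete_geodesic A dA k w" "w 0 = \<eta> 0" "w k = \<eta> n"
    using assms \<eta> unfolding stably_embedded_def discretely_geodesic_def by meson
  have "morse M d \<mu> (w ` {..k})" using assms w unfolding stably_embedded_def by blast
  moreover have "\<eta> 0 \<in> w ` {..k}" "\<eta> n \<in> w ` {..k}" using w by (metis atMost_iff imageI le0 order_refl)+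
  ultimately have "near d (\<mu> L) (w ` {..k}) (\<eta> i)" using L \<eta> i unfolding morse_def by blast
  then show "near d (\<mu> L) A (\<eta> i)"
    by (rule near_mono) (use w in \<open>auto simp: discrete_geodesic_def\<close>)
qed

text \<open>
  The radius in the conclusion does not involve \<open>\<sigma>\<close>: a point of \<open>A\<close> that is only known to be near \<open>B\<close> on a
  large scale can be moved, by at most that scale, to where \<open>A\<close> and \<open>B\<close> are close on the fixed
  scale. The point is found on a geodesic from \<open>x\<close> to \<open>B\<close>, as the one nearest to \<open>a\<close>.
\<close>
lemma coarse_intersection:
  assumes geo: "discretely_geodesic M d" and D: "D \<ge> 0"
    and A: "morse M d \<mu> A" and B: "morse M d \<mu> B"
    and a: "a \<in> M" "near d D A a" "near d D B a"
    and x: "x \<in> M" "near d D A x" "near d \<sigma> B x"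
  shows "\<exists>y\<in>M. d x y \<le> \<sigma> \<and> near d (center_radius \<mu> D) A y \<and> near d (center_radius \<mu> D) B y"
proof -
  obtain b where b: "b \<in> B" "d x b \<le> \<sigma>" using x unfolding near_def by blast
  have bM: "b \<in> M" using b B unfolding morse_def by blast
  have "near d D B b" using b B D unfolding morse_def by (intro near_self) auto
  obtain n w where w: "discrete_geodesic M d n w" "w 0 = x" "w n = b"
    using geo x bM unfolding discretely_geodesic_def by meson
  obtain k where k: "k \<le> n" "near d (center_radius \<mu> D) A (w k)" "near d (center_radius \<mu> D) B (w k)"
    using triangle_center[OF geo a(1) w(1) A _ a(2) B _ a(3) D] w x \<open>near d D B b\<close> by auto
  moreover have "d x (w k) \<le> \<sigma>"
    using discrete_geodesicD(1)[OF w(1), of 0 k] discrete_geodesicD(1)[OF w(1), of 0 n] w k b by simp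
  ultimately show ?thesis using discrete_geodesicD(2)[OF w(1), of k] by blast
qed

text \<open>
  A Helly property for three Morse sets. It is used with \<open>D = 0\<close> for the three sides of a triangle, and
  with the given \<open>D\<close> for three cosets.
\<close>
lemma common_center:
  assumes geo: "discretely_geodesic M d" and D: "D \<ge> 0"
    and mor: "morse M d \<mu> P" "morse M d \<mu> Q" "morse M d \<mu> T"
    and p: "p \<in> M" "near d D P p" "near d D Q p"
    and q: "q \<in> M" "near d D Q q" "near d D T q"
    and r: "r \<in> M" "near d D T r" "near d D P r"
  shows "\<exists>c\<in>M. near d (center_radius \<mu> D) P c \<and> near d (center_radius \<mu> D) Q c \<and> near d (center_radius \<mu> D) T c"
proof -
  obtain n w where w: "discrete_geodesic M d n w" "w 0 = p" "w n = q"
    using geo p q unfolding discretely_geodesic_def by meson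
  obtain k where k: "k \<le> n" "near d (center_radius \<mu> D) P (w k)" "near d (center_radius \<mu> D) T (w k)"
    using triangle_center[OF geo r(1) w(1) mor(1) _ _ mor(3)] w p q r D by auto
  have "near d (\<mu> (1 + 2 * D) + D) Q (w k)"
    by (rule morse_near_endpoints[OF mor(2) geodesic_imp_quasigeodesic[OF w(1)]]) (use w p q k D in auto)
  then have "near d (center_radius \<mu> D) Q (w k)" by (auto simp: center_radius_def elim!: near_mono)
  then show ?thesis using k discrete_geodesicD(2)[OF w(1), of k] by blast
qed

end

section \<open>A coarse Helly theorem\<close>

text \<open>
  The ambient space for the Helly argument is one stably embedded set \<open>A\<close>, with its own metric \<open>dA\<close>
  for choosing nearest points.
\<close>
locale stable_subspace = Metric_space M d + A: Metric_space A dA for M :: "'x set" and d and A :: "'x set" and dA +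
  fixes \<mu> :: "real \<Rightarrow> real" and K D :: real
  assumes geo: "discretely_geodesic M d" and stab: "stably_embedded M d K \<mu> A dA"
    and K: "K \<ge> 1" and D: "D \<ge> 0"
begin

text \<open>
  Here \<open>\<rho>\<close> is the scale at which shadows are taken. Points of \<open>A\<close> near a common
  center of geodesics of \<open>A\<close> are within \<open>\<epsilon>0\<close> of each other in \<open>dA\<close>. A geodesic between points
  of a shadow stays within \<open>\<sigma>\<close> of the set that casts it, and a point of \<open>A\<close> within \<open>\<sigma>\<close> of
  that set is within \<open>\<delta>\<close> of its shadow, in \<open>dA\<close>. The nearest point of a shadow is within \<open>\<tau>\<close>,
  again in \<open>dA\<close>, of each geodesic from the base point to the shadow, and \<open>\<kappa>\<close> bounds the distance
  to the set that casts the shadow at that place of the geodesic. None of these constants involves the number of sets.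
\<close>

definition "\<rho> = 2 * center_radius \<mu> D"
definition "\<epsilon>0 = K * (2 * center_radius \<mu> 0) + K"
definition "\<sigma> = \<mu> (K + 2 * \<rho>) + \<rho>"
definition "\<delta> = K * (\<sigma> + center_radius \<mu> D) + K"
definition "\<tau> = 2 * \<epsilon>0 + \<delta> + 1"
definition "\<kappa> = K * \<tau> + K + \<rho>"
definition "helly_radius = (K * \<tau> + K) + max (\<mu> (K + 2 * \<kappa>) + \<kappa>) (\<kappa> + (K * (2 * \<tau>) + K))"

lemma AM: "A \<subseteq> M" and mA: "morse M d \<mu> A"
  using stab stably_embedded_imp_morse unfolding stably_embedded_def by blast+

lemma geoA: "discretely_geodesic A dA"
  using stab unfolding stably_embedded_def by blast

lemma dist_bounds:
  assumes "x \<in> A" "y \<in> A"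
  shows "d x y \<le> K * dA x y + K" "dA x y \<le> K * d x y + K"
  using stab assms unfolding stably_embedded_def by blast+

lemma d_le: "x \<in> A \<Longrightarrow> y \<in> A \<Longrightarrow> dA x y \<le> s \<Longrightarrow> d x y \<le> K * s + K"
  using dist_bounds(1)[of x y] K mult_left_mono[of "dA x y" s K] by linarith

lemma dA_le: "x \<in> A \<Longrightarrow> y \<in> A \<Longrightarrow> d x y \<le> s \<Longrightarrow> dA x y \<le> K * s + K"
  using dist_bounds(2)[of x y] K mult_left_mono[of "d x y" s K] by linarith

lemma quasigeodesic_in_space:
  assumes w: "discrete_geodesic A dA n w"
  shows "discrete_quasigeodesic M d K n w"
proof -
  have "\<bar>real i - real j\<bar> / K - K \<le> d (w i) (w j) \<and> d (w i) (w j) \<le> K * \<bar>real i - real j\<bar> + K"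
    if ij: "i \<le> n" "j \<le> n" for i j
  proof -
    have e: "dA (w i) (w j) = \<bar>real i - real j\<bar>" and mem: "w i \<in> A" "w j \<in> A"
      using discrete_geodesicD[OF w] ij by auto
    have "\<bar>real i - real j\<bar> / K \<le> d (w i) (w j) + 1"
      using dist_bounds(2)[OF mem] K unfolding e by (simp add: field_simps)
    then show ?thesis using dist_bounds(1)[OF mem] K unfolding e by linarith
  qed
  then show ?thesis using w AM unfolding discrete_quasigeodesic_def discrete_geodesic_def by blast
qed

lemma geodesic_near_morse:
  assumes B: "morse M d \<mu> B" and w: "discrete_geodesic A dA n w" and s: "s \<ge> 0"
    and ends: "near d s B (w 0)" "near d s B (w n)" and i: "i \<le> n"
  shows "near d (\<mu> (K + 2 * s) + s) B (w i)"
  using morse_near_endpoints[OF B quasigeodesic_in_space[OF w] K s ends i] .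

definition shadow :: "'x set \<Rightarrow> 'x set" where
  "shadow B = {a \<in> A. near d \<rho> B a}"

lemma shadow_point:
  assumes y: "y \<in> M" "near d (center_radius \<mu> D) A y"
  obtains a where "a \<in> A" "d y a \<le> center_radius \<mu> D" "\<And>C. C \<subseteq> M \<Longrightarrow> near d (center_radius \<mu> D) C y \<Longrightarrow> a \<in> shadow C"
proof -
  obtain a where a: "a \<in> A" "d y a \<le> center_radius \<mu> D" using y unfolding near_def by blast
  have "near d (center_radius \<mu> D + center_radius \<mu> D) C a" if "C \<subseteq> M" "near d (center_radius \<mu> D) C y" for C
    using that a AM y commute by (intro near_triangle[of _ _ y]) auto
  then show ?thesis using a that unfolding shadow_def \<rho>_def by auto
qed

text \<open>
  This is where closeness of \<open>B\<close> and \<open>C\<close> to each other, possibly far away from \<open>A\<close>, is transferred to \<open>A\<close>.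
\<close>
lemma common_shadow_point:
  assumes B: "morse M d \<mu> B" and C: "morse M d \<mu> C"
    and AB: "\<exists>a\<in>A. near d D B a" and AC: "\<exists>a\<in>A. near d D C a" and BC: "\<exists>b\<in>B. near d D C b"
  shows "shadow B \<inter> shadow C \<noteq> {}"
proof -
  obtain a a' b where p: "a \<in> A" "near d D B a" "a' \<in> A" "near d D C a'" "b \<in> B" "near d D C b"
    using assms by blast
  have sub: "B \<subseteq> M" "C \<subseteq> M" using B C unfolding morse_def by auto
  obtain c where c: "c \<in> M" "near d (center_radius \<mu> D) A c" "near d (center_radius \<mu> D) B c" "near d (center_radius \<mu> D) C c"
    using common_center[OF geo D mA B C _ near_self[OF p(1) AM D] p(2) _ near_self[OF p(5) sub(1) D] p(6)
        _ p(4) near_self[OF p(3) AM D]]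
      p sub AM by blast
  obtain q where "\<And>C. C \<subseteq> M \<Longrightarrow> near d (center_radius \<mu> D) C c \<Longrightarrow> q \<in> shadow C"
    using shadow_point[OF c(1,2)] by metis
  then show ?thesis using c sub by blast
qed

lemma center_radius_nonneg:
  assumes "morse M d \<mu> B" "x \<in> A" "near d D B x"
  shows "center_radius \<mu> D \<ge> 0"
proof -
  have "\<exists>c\<in>M. near d (center_radius \<mu> D) A c \<and> near d (center_radius \<mu> D) A c \<and> near d (center_radius \<mu> D) B c"
    using near_self[OF assms(2) AM D] assms AM by (intro common_center[OF geo D mA mA assms(1), of x x x]) auto
  then show ?thesis unfolding near_def by (meson nonneg order_trans)
qed

text \<open>
  Consider the triangle of \<open>dA\<close>-geodesics between \<open>z\<close>, \<open>c\<close> and a point of the shadow. Its center is near the side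
  from \<open>c\<close> to the shadow, hence near the shadow, and it is near the side from \<open>z\<close> to \<open>c\<close>. As \<open>c\<close> is
  nearest to \<open>z\<close>, the center cannot be far before \<open>c\<close>. It is also near the third side. The slack 1
  in the choice of \<open>c\<close> allows for real distances, whose minimum may fail to be attained.
\<close>
lemma nearest_shadow_point_on_geodesic:
  assumes B: "morse M d \<mu> B" and AB: "\<exists>a\<in>A. near d D B a" and z: "z \<in> A"
    and c: "c \<in> shadow B" and nearest: "\<And>x. x \<in> shadow B \<Longrightarrow> dA z c \<le> dA z x + 1"
    and w: "discrete_geodesic A dA n w" "w 0 = z" "w n \<in> shadow B"
  shows "\<exists>i\<le>n. dA c (w i) \<le> \<tau>"
proof -
  have BM: "B \<subseteq> M" using B unfolding morse_def by auto
  have cA: "c \<in> A" and qA: "w n \<in> A" using c w unfolding shadow_def by auto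
  obtain a where a: "a \<in> A" "near d D B a" using AB by blast
  have th: "center_radius \<mu> D \<ge> 0" using center_radius_nonneg[OF B a] .
  obtain m u where u: "discrete_geodesic A dA m u" "u 0 = z" "u m = c"
    using geoA z cA unfolding discretely_geodesic_def by meson
  obtain l v where v: "discrete_geodesic A dA l v" "v 0 = c" "v l = w n"
    using geoA qA cA unfolding discretely_geodesic_def by meson
  have mor: "morse M d \<mu> (u ` {..m})" "morse M d \<mu> (v ` {..l})" "morse M d \<mu> (w ` {..n})"
    using stab u v w unfolding stably_embedded_def by blast+
  have self: "near d 0 (f ` {..k}) (f i)" if "i \<le> k" "f i \<in> M" for f :: "nat \<Rightarrow> 'x" and i k
    using that unfolding near_def by (intro bexI[of _ "f i"]) auto
  have n1: "near d 0 (u ` {..m}) c" "near d 0 (v ` {..l}) c" using self[of m m u] self[of 0 l v] u v cA AM by auto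
  have n2: "near d 0 (v ` {..l}) (w n)" "near d 0 (w ` {..n}) (w n)" using self[of l l v] self[of n n w] v qA AM by auto
  have n3: "near d 0 (w ` {..n}) z" "near d 0 (u ` {..m}) z" using self[of 0 n w] self[of 0 m u] u w z AM by auto
  obtain y where y: "y \<in> M" "near d (center_radius \<mu> 0) (u ` {..m}) y" "near d (center_radius \<mu> 0) (v ` {..l}) y"
    "near d (center_radius \<mu> 0) (w ` {..n}) y"
    using common_center[OF geo order_refl mor _ n1 _ n2 _ n3] cA qA z AM by blast
  obtain i j k where ijk: "i \<le> m" "d y (u i) \<le> center_radius \<mu> 0" "j \<le> l" "d y (v j) \<le> center_radius \<mu> 0"
    "k \<le> n" "d y (w k) \<le> center_radius \<mu> 0"
    using y unfolding near_def by auto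
  have mem: "u i \<in> A" "v j \<in> A" "w k \<in> A"
    using discrete_geodesicD(2)[OF u(1)] discrete_geodesicD(2)[OF v(1)] discrete_geodesicD(2)[OF w(1)] ijk by auto
  then have memM: "u i \<in> M" "v j \<in> M" "w k \<in> M" using AM by auto
  have "d (u i) (v j) \<le> 2 * center_radius \<mu> 0" "d (u i) (w k) \<le> 2 * center_radius \<mu> 0"
    using triangle[of "u i" y "v j"] triangle[of "u i" y "w k"] commute[of "u i" y] memM y(1) ijk by auto
  then have uv: "dA (u i) (v j) \<le> \<epsilon>0" and uw: "dA (u i) (w k) \<le> \<epsilon>0"
    unfolding \<epsilon>0_def using mem by (auto intro: dA_le)
  have "near d \<sigma> B (v j)"
    unfolding \<sigma>_def using c v w ijk th by (intro geodesic_near_morse[OF B v(1)]) (auto simp: shadow_def \<rho>_def)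
  moreover have "near d D A a" "near d D A (v j)" "a \<in> M"
    using near_self[OF _ AM D] a mem AM by auto
  ultimately obtain x where x: "x \<in> M" "d (v j) x \<le> \<sigma>"
    "near d (center_radius \<mu> D) A x" "near d (center_radius \<mu> D) B x"
    using coarse_intersection[OF geo D mA B _ _ a(2) memM(2)] by blast
  obtain x' where x': "x' \<in> A" "d x x' \<le> center_radius \<mu> D" "x' \<in> shadow B"
    using shadow_point[OF x(1,3)] x BM by metis
  have "d (v j) x' \<le> \<sigma> + center_radius \<mu> D"
    using triangle[OF memM(2) x(1), of x'] x x' AM by auto
  then have vx: "dA (v j) x' \<le> \<delta>" unfolding \<delta>_def using mem x' by (auto intro: dA_le)
  have "dA z c = dA z (u i) + dA (u i) c"
    using discrete_geodesicD(1)[OF u(1), of 0 m] discrete_geodesicD(1)[OF u(1), of 0 i]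
      discrete_geodesicD(1)[OF u(1), of i m] u ijk by auto
  moreover have "dA z x' \<le> dA z (u i) + dA (u i) (v j) + dA (v j) x'"
    using A.triangle[of z "u i" x'] A.triangle[of "u i" "v j" x'] z mem x' by linarith
  ultimately have "dA (u i) c \<le> \<epsilon>0 + \<delta> + 1" using nearest[OF x'(3)] uv vx by linarith
  then have "dA c (w k) \<le> \<tau>"
    using A.triangle[of c "u i" "w k"] A.commute[of c "u i"] cA mem uw unfolding \<tau>_def by linarith
  then show ?thesis using ijk by blast
qed

text \<open>
  The center is the farthest from \<open>z\<close> among the points of the shadows nearest to \<open>z\<close>; finiteness
  makes the farthest one exist. In a tree, the geodesic from \<open>z\<close> to a common point of two shadows
  enters each shadow at its nearest point and then stays inside, so the farther of the two entry
  points lies in both.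
\<close>
theorem coarse_helly:
  assumes fin: "finite \<F>" and "A \<noteq> {}" and mor: "\<And>B. B \<in> \<F> \<Longrightarrow> morse M d \<mu> B"
    and AB: "\<And>B. B \<in> \<F> \<Longrightarrow> \<exists>a\<in>A. near d D B a"
    and BC: "\<And>B C. B \<in> \<F> \<Longrightarrow> C \<in> \<F> \<Longrightarrow> \<exists>b\<in>B. near d D C b"
  shows "\<exists>x\<in>A. \<forall>B\<in>\<F>. near d helly_radius B x"
proof (cases "\<F> = {}")
  case False
  obtain z where z: "z \<in> A" using assms by blast
  have "\<exists>c\<in>shadow B. \<forall>x\<in>shadow B. dA z c \<le> dA z x + 1" if B: "B \<in> \<F>" for B
  proof -
    obtain q where "q \<in> shadow B" using common_shadow_point[OF mor mor AB AB BC, OF B B B B B B] by blast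
    \<comment> \<open>Rounding down makes a minimizer exist, which is then nearest up to an error of 1.\<close>
    then obtain c where c: "c \<in> shadow B" "\<And>x. x \<in> shadow B \<Longrightarrow> nat \<lfloor>dA z c\<rfloor> \<le> nat \<lfloor>dA z x\<rfloor>"
      using ex_has_least_nat[of "\<lambda>x. x \<in> shadow B" q "\<lambda>x. nat \<lfloor>dA z x\<rfloor>"] by blast
    have "dA z c \<le> dA z x + 1" if "x \<in> shadow B" for x
      using c(2)[OF that] A.nonneg[of z c] A.nonneg[of z x] by linarith
    then show ?thesis using c by blast
  qed
  then obtain c where c: "\<And>B. B \<in> \<F> \<Longrightarrow> c B \<in> shadow B"
    "\<And>B x. B \<in> \<F> \<Longrightarrow> x \<in> shadow B \<Longrightarrow> dA z (c B) \<le> dA z x + 1"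
    by metis
  \<comment> \<open>The set whose nearest point is farthest from \<open>z\<close>, obtained by minimizing the negative distance.\<close>
  obtain B where B: "B \<in> \<F>" "\<And>C. C \<in> \<F> \<Longrightarrow> dA z (c C) \<le> dA z (c B)"
    using ex_is_arg_min_if_finite[OF fin False, of "\<lambda>B. - dA z (c B)"] by (auto simp: is_arg_min_linorder)
  have cA: "c C \<in> A" if "C \<in> \<F>" for C using c that unfolding shadow_def by auto
  have "near d helly_radius C (c B)" if C: "C \<in> \<F>" for C
  proof -
    have CM: "C \<subseteq> M" using mor[OF C] unfolding morse_def by auto
    obtain q where q: "q \<in> shadow B" "q \<in> shadow C"
      using common_shadow_point[OF mor mor AB AB BC, OF B(1) C B(1) C B(1) C] by blast
    have qA: "q \<in> A" using q unfolding shadow_def by auto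
    obtain n w where w: "discrete_geodesic A dA n w" "w 0 = z" "w n = q"
      using geoA z qA unfolding discretely_geodesic_def by meson
    obtain i where i: "i \<le> n" "dA (c B) (w i) \<le> \<tau>"
      using nearest_shadow_point_on_geodesic[OF mor[OF B(1)] AB[OF B(1)] z c(1)[OF B(1)] c(2)[OF B(1)] w(1,2)] w q by auto
    obtain j where j: "j \<le> n" "dA (c C) (w j) \<le> \<tau>"
      using nearest_shadow_point_on_geodesic[OF mor[OF C] AB[OF C] z c(1)[OF C] c(2)[OF C] w(1,2)] w q by auto
    have mem: "w i \<in> A" "w j \<in> A" using discrete_geodesicD(2)[OF w(1)] i j by auto
    have \<tau>0: "\<tau> \<ge> 0" using j A.nonneg order_trans by blast
    have "near d \<rho> C (c C)" using c C unfolding shadow_def by auto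
    moreover have "d (w j) (c C) \<le> K * \<tau> + K" using j mem cA C A.commute by (auto intro: d_le)
    ultimately have "near d (\<rho> + (K * \<tau> + K)) C (w j)"
      using mem cA[OF C] AM CM by (intro near_triangle) auto
    then have wj: "near d \<kappa> C (w j)" unfolding \<kappa>_def by (rule near_mono) auto
    have wn: "near d \<kappa> C (w n)"
      using q w \<tau>0 K unfolding shadow_def \<kappa>_def by (auto elim!: near_mono)
    have wi: "near d (max (\<mu> (K + 2 * \<kappa>) + \<kappa>) (\<kappa> + (K * (2 * \<tau>) + K))) C (w i)"
    proof (cases "j \<le> i")
      \<comment> \<open>Both ends \<open>w j\<close> and \<open>w n = q\<close> of the final segment are near the Morse set \<open>C\<close>.\<close>
      case True
      have "near d (\<mu> (K + 2 * \<kappa>) + \<kappa>) C (w (j + (i - j)))"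
      proof (rule geodesic_near_morse[OF mor[OF C] discrete_geodesic_segment[OF w(1) j(1)]])
        show "\<kappa> \<ge> 0" using wj unfolding near_def by (meson nonneg order_trans)
      qed (use True i j wj wn in auto)
      then show ?thesis using True by (auto elim!: near_mono)
    next
      \<comment> \<open>The choice of \<open>B\<close> forces \<open>i\<close> to be at most slightly smaller than \<open>j\<close>.\<close>
      case False
      have "real i = dA z (w i)" "real j = dA z (w j)" "dA (w i) (w j) = real j - real i"
        using discrete_geodesicD(1)[OF w(1), of 0 i] discrete_geodesicD(1)[OF w(1), of 0 j]
          discrete_geodesicD(1)[OF w(1), of i j] w i j False by auto
      moreover have "dA z (c B) \<le> dA z (w i) + \<tau>" "dA z (w j) \<le> dA z (c C) + \<tau>"
        using A.triangle[of z "w i" "c B"] A.commute[of "w i" "c B"] A.triangle[of z "c C" "w j"]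
          z mem cA B C i j by auto
      ultimately have "dA (w i) (w j) \<le> 2 * \<tau>" using B(2)[OF C] by linarith
      then have "d (w i) (w j) \<le> K * (2 * \<tau>) + K" using mem by (auto intro: d_le)
      then have "near d (\<kappa> + (K * (2 * \<tau>) + K)) C (w i)"
        using mem AM CM by (intro near_triangle[OF wj]) auto
      then show ?thesis by (auto elim!: near_mono)
    qed
    have "near d (max (\<mu> (K + 2 * \<kappa>) + \<kappa>) (\<kappa> + (K * (2 * \<tau>) + K)) + (K * \<tau> + K)) C (c B)"
      using mem cA[OF B(1)] i AM CM d_le[OF cA[OF B(1)] mem(1) i(2)] by (intro near_triangle[OF wi]) auto
    then show ?thesis unfolding helly_radius_def by (auto elim!: near_mono)
  qed
  then show ?thesis using cA B by blast
qed (use assms in auto)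

end

section \<open>The word metric\<close>

lemma step_path_length:
  assumes "Metric_space X d" and w: "\<And>i. i \<le> n \<Longrightarrow> w i \<in> X" and step: "\<And>i. i < n \<Longrightarrow> d (w i) (w (Suc i)) \<le> 1"
    and ij: "i \<le> j" "j \<le> n"
  shows "d (w i) (w j) \<le> real j - real i"
proof -
  interpret Metric_space X d by fact
  show ?thesis using ij
  proof (induction j)
    case (Suc j)
    show ?case
    proof (cases "i = Suc j")
      case False
      then have "i \<le> j" using Suc by auto
      then show ?thesis
        using Suc.IH Suc.prems triangle[of "w i" "w j" "w (Suc j)"] w step[of j] by fastforce
    qed (use w Suc in auto)
  qed (use w in auto)
qed

lemma shortest_step_path_geodesic:
  assumes "Metric_space X d" and w: "\<And>i. i \<le> n \<Longrightarrow> w i \<in> X" and step: "\<And>i. i < n \<Longrightarrow> d (w i) (w (Suc i)) \<le> 1"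
    and len: "d (w 0) (w n) = n"
  shows "discrete_geodesic X d n w"
proof -
  interpret Metric_space X d by fact
  have main: "d (w i) (w j) = real j - real i" if "i \<le> j" "j \<le> n" for i j
  proof -
    have le: "d (w k) (w l) \<le> real l - real k" if "k \<le> l" "l \<le> n" for k l
      using step_path_length[of X d n w, OF assms(1) w step] that by blast
    show ?thesis
      using le[of 0 i] le[of i j] le[of j n] that len w[of 0] w[of i] w[of j] w[of n]
        triangle[of "w 0" "w i" "w n"] triangle[of "w i" "w j" "w n"] by simp
  qed
  show ?thesis unfolding discrete_geodesic_def
  proof (intro conjI allI impI)
    fix i j assume "i \<le> n" "j \<le> n"
    then show "d (w i) (w j) = \<bar>real i - real j\<bar>"
      using main[of i j] main[of j i] commute[of "w i" "w j"] by (cases "i \<le> j") auto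
  qed (use w in auto)
qed

text \<open>
  \<^const>\<open>Metric_space\<close> requires symmetry on the whole type, which a word metric has only on
  the carrier.
\<close>
definition restricted_dist :: "'x set \<Rightarrow> ('x \<Rightarrow> 'x \<Rightarrow> nat) \<Rightarrow> 'x \<Rightarrow> 'x \<Rightarrow> real" where
  "restricted_dist X d x y = (if x \<in> X \<and> y \<in> X then real (d x y) else 0)"

locale generated_group = group G for G :: "('a, 'b) monoid_scheme" (structure) +
  fixes S :: "'a set"
  assumes gen: "finite_generating_set G S"
begin

abbreviation "wd \<equiv> word_dist G S"

definition spells :: "'a list \<Rightarrow> 'a \<Rightarrow> bool" where
  "spells ws g \<longleftrightarrow> set ws \<subseteq> S \<union> m_inv G ` S \<and> foldr (\<otimes>) ws \<one> = g"

lemma letters: "S \<union> m_inv G ` S \<subseteq> carrier G" and finite_letters: "finite (S \<union> m_inv G ` S)"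
  using gen unfolding finite_generating_set_def by auto

lemma spells_closed: "spells ws g \<Longrightarrow> g \<in> carrier G"
proof (induction ws arbitrary: g)
  case (Cons a ws)
  then have "a \<in> carrier G" "foldr (\<otimes>) ws \<one> \<in> carrier G" 
    using letters unfolding spells_def by auto
  then show ?case using Cons unfolding spells_def by auto
qed (auto simp: spells_def)

lemma spells_append:
  assumes "spells us g" "spells vs h"
  shows "spells (us @ vs) (g \<otimes> h)"
  using assms(1)
proof (induction us arbitrary: g)
  case Nil
  then show ?case using assms(2) spells_closed by (auto simp: spells_def)
next
  case (Cons a us)
  have a: "a \<in> carrier G" "a \<in> S \<union> m_inv G ` S" "spells us (foldr (\<otimes>) us \<one>)" "g = a \<otimes> foldr (\<otimes>) us \<one>"
    using Cons.prems letters unfolding spells_def by auto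
  have "spells (us @ vs) (foldr (\<otimes>) us \<one> \<otimes> h)" using Cons.IH a by blast
  then show ?case
    using a spells_closed[OF a(3)] spells_closed[OF assms(2)] by (auto simp: spells_def m_assoc)
qed

lemma spells_letter: "a \<in> S \<union> m_inv G ` S \<Longrightarrow> spells [a] a"
  using letters by (auto simp: spells_def)

lemma spells_inverse:
  assumes "spells ws g"
  shows "\<exists>vs. length vs = length ws \<and> spells vs (inv g)"
  using assms
proof (induction ws arbitrary: g)
  case Nil
  then show ?case by (auto simp: spells_def)
next
  case (Cons a ws)
  have a: "a \<in> carrier G" "a \<in> S \<union> m_inv G ` S" "spells ws (foldr (\<otimes>) ws \<one>)" "g = a \<otimes> foldr (\<otimes>) ws \<one>"
    using Cons.prems letters unfolding spells_def by auto
  obtain vs where vs: "length vs = length ws" "spells vs (inv (foldr (\<otimes>) ws \<one>))" using Cons.IH a by blast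
  have "inv a \<in> S \<union> m_inv G ` S" using a letters by auto
  then have "spells (vs @ [inv a]) (inv g)"
    using spells_append[OF vs(2) spells_letter] a spells_closed[OF a(3)] by (simp add: inv_mult_group)
  then show ?case using vs by (intro exI[of _ "vs @ [inv a]"]) auto
qed

lemma exists_word: "g \<in> carrier G \<Longrightarrow> \<exists>ws. spells ws g"
proof -
  have "\<exists>ws. spells ws g" if "g \<in> generate G S" for g
    using that
  proof (induction rule: generate.induct)
    case one
    then show ?case by (intro exI[of _ "[]"]) (auto simp: spells_def)
  next
    case (eng h1 h2)
    then show ?case using spells_append by blast
  qed (use spells_letter in blast)+
  then show "g \<in> carrier G \<Longrightarrow> \<exists>ws. spells ws g" using gen unfolding finite_generating_set_def by auto
qed

lemma word_length_eq: "word_length G S g = (LEAST n. \<exists>ws. length ws = n \<and> spells ws g)"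
  unfolding word_length_def spells_def by (rule arg_cong[of _ _ Least]) auto

lemma word_length_le: "spells ws g \<Longrightarrow> word_length G S g \<le> length ws"
  unfolding word_length_eq by (rule Least_le) auto

lemma shortest_word: "g \<in> carrier G \<Longrightarrow> \<exists>ws. length ws = word_length G S g \<and> spells ws g"
  unfolding word_length_eq by (rule LeastI_ex) (use exists_word in auto)

lemma word_length_one: "word_length G S \<one> = 0"
  using word_length_le[of "[]"] by (auto simp: spells_def)

lemma word_length_eq_0: "g \<in> carrier G \<Longrightarrow> word_length G S g = 0 \<longleftrightarrow> g = \<one>"
  using shortest_word[of g] word_length_one by (auto simp: spells_def)

lemma word_length_inv: "g \<in> carrier G \<Longrightarrow> word_length G S (inv g) = word_length G S g"
proof -
  have le: "word_length G S (inv g) \<le> word_length G S g" if "g \<in> carrier G" for g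
    using shortest_word[OF that] spells_inverse word_length_le by metis
  show "g \<in> carrier G \<Longrightarrow> word_length G S (inv g) = word_length G S g"
    using le[of g] le[of "inv g"] by auto
qed

lemma word_length_mult:
  assumes "g \<in> carrier G" "h \<in> carrier G"
  shows "word_length G S (g \<otimes> h) \<le> word_length G S g + word_length G S h"
  using shortest_word[OF assms(1)] shortest_word[OF assms(2)] spells_append word_length_le
  by (metis length_append)

lemma word_dist_commute: "x \<in> carrier G \<Longrightarrow> y \<in> carrier G \<Longrightarrow> wd x y = wd y x"
  using word_length_inv[of "inv x \<otimes> y"] unfolding word_dist_def by (simp add: inv_mult_group)

lemma word_dist_triangle:
  assumes "x \<in> carrier G" "y \<in> carrier G" "z \<in> carrier G"
  shows "wd x z \<le> wd x y + wd y z"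
proof -
  have "inv x \<otimes> z = (inv x \<otimes> y) \<otimes> (inv y \<otimes> z)"
    using assms by (simp add: m_assoc[symmetric] inv_solve_right') (simp add: m_assoc)
  then show ?thesis
    using assms word_length_mult[of "inv x \<otimes> y" "inv y \<otimes> z"] unfolding word_dist_def by simp
qed

lemma word_dist_eq_0: "x \<in> carrier G \<Longrightarrow> y \<in> carrier G \<Longrightarrow> wd x y = 0 \<longleftrightarrow> x = y"
  unfolding word_dist_def
  by (metis inv_closed inv_comm inv_equality inv_inv m_closed r_inv word_length_eq_0 l_inv)

lemma word_dist_left_invariant:
  assumes "g \<in> carrier G" "x \<in> carrier G" "y \<in> carrier G"
  shows "wd (g \<otimes> x) (g \<otimes> y) = wd x y"
proof -
  have "inv (g \<otimes> x) \<otimes> (g \<otimes> y) = inv x \<otimes> y"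
    using assms by (simp add: inv_mult_group m_assoc inv_solve_left')
  then show ?thesis unfolding word_dist_def by simp
qed

abbreviation "word_metric \<equiv> restricted_dist (carrier G) wd"

lemma Metric_space_word_metric: "Metric_space (carrier G) word_metric"
  by standard
    (use word_dist_commute word_dist_eq_0 word_dist_triangle
      in \<open>auto simp: restricted_dist_def simp flip: of_nat_add\<close>)

lemma discretely_geodesic_word_metric: "discretely_geodesic (carrier G) word_metric"
  unfolding discretely_geodesic_def
proof (intro ballI)
  fix x y assume x: "x \<in> carrier G" and y: "y \<in> carrier G"
  obtain ws where ws: "length ws = wd x y" "spells ws (inv x \<otimes> y)"
    using shortest_word[of "inv x \<otimes> y"] x y unfolding word_dist_def by auto
  let ?n = "wd x y"
  define w where "w i = x \<otimes> foldr (\<otimes>) (take i ws) \<one>" for i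
  have pre: "spells (take i ws) (foldr (\<otimes>) (take i ws) \<one>)" for i
    using ws set_take_subset[of i ws] by (auto simp: spells_def)
  have w: "w i \<in> carrier G" for i using spells_closed[OF pre] x by (simp add: w_def)
  have step: "word_metric (w i) (w (Suc i)) \<le> 1" if "i < ?n" for i
  proof -
    have a: "ws ! i \<in> S \<union> m_inv G ` S" using that ws nth_mem[of i ws] unfolding spells_def by (metis subsetD)
    have "spells (take (Suc i) ws) (foldr (\<otimes>) (take i ws) \<one> \<otimes> ws ! i)"
      using spells_append[OF pre spells_letter[OF a], of i] that ws by (simp add: take_Suc_conv_app_nth)
    then have e: "w (Suc i) = x \<otimes> (foldr (\<otimes>) (take i ws) \<one> \<otimes> ws ! i)" unfolding w_def spells_def by simp
    have "wd (w i) (w (Suc i)) = word_length G S (ws ! i)"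
      using word_dist_left_invariant[OF x] spells_closed[OF pre, of i] a letters
      unfolding e unfolding w_def word_dist_def by (auto simp: m_assoc[symmetric])
    then show ?thesis using word_length_le[OF spells_letter[OF a]] by (auto simp: restricted_dist_def)
  qed
  have ends: "w 0 = x" "w ?n = y" using x y ws unfolding w_def by (auto simp: spells_def m_assoc[symmetric])
  have "discrete_geodesic (carrier G) word_metric ?n w"
    by (rule shortest_step_path_geodesic[OF Metric_space_word_metric])
      (use w step ends x y in \<open>auto simp: restricted_dist_def\<close>)
  then show "\<exists>n w. discrete_geodesic (carrier G) word_metric n w \<and> w 0 = x \<and> w n = y"
    using ends by blast
qed

lemma finite_word_ball: "finite {g \<in> carrier G. real (word_length G S g) \<le> R}"
proof (rule finite_subset)
  let ?W = "{ws. set ws \<subseteq> S \<union> m_inv G ` S \<and> length ws \<le> nat \<lfloor>R\<rfloor>}"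
  show "{g \<in> carrier G. real (word_length G S g) \<le> R} \<subseteq> (\<lambda>ws. foldr (\<otimes>) ws \<one>) ` ?W"
  proof
    fix g assume g: "g \<in> {g \<in> carrier G. real (word_length G S g) \<le> R}"
    then obtain ws where ws: "length ws = word_length G S g" "spells ws g" using shortest_word by blast
    then have "length ws \<le> nat \<lfloor>R\<rfloor>" using g by (simp add: le_nat_floor)
    then show "g \<in> (\<lambda>ws. foldr (\<otimes>) ws \<one>) ` ?W" using ws unfolding spells_def by blast
  qed
  show "finite ((\<lambda>ws. foldr (\<otimes>) ws \<one>) ` ?W)" using finite_lists_length_le[OF finite_letters] by auto
qed

end

section \<open>Geodesics in the Cayley graph\<close>

context generated_group
begin

lemma cayley_point_props:
  assumes "p \<in> cayley_graph G S"
  shows "\<exists>v. p v \<noteq> 0" and "p v \<le> 1" and "p v \<noteq> 0 \<Longrightarrow> v \<in> carrier G"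
    and "p v \<noteq> 0 \<Longrightarrow> p v' \<noteq> 0 \<Longrightarrow> wd v v' \<le> 1"
    and "{w. p w \<noteq> 0} \<subseteq> {x, y} \<Longrightarrow> x \<noteq> y \<Longrightarrow> p x + p y = 1"
proof -
  obtain a b t where p: "p = edge_point a b t" "a \<in> carrier G" "b \<in> carrier G" "wd a b \<le> 1" "0 \<le> t" "t \<le> 1"
    using assms unfolding cayley_graph_def by auto
  show "\<exists>v. p v \<noteq> 0"
  proof (cases "t = 0")
    case True
    then show ?thesis using p by (intro exI[of _ a]) (auto simp: edge_point_def)
  next
    case False
    then have "p b \<noteq> 0" using p by (auto simp: edge_point_def)
    then show ?thesis by blast
  qed
  show "p v \<le> 1" using p by (auto simp: edge_point_def)
  have sub: "p v \<noteq> 0 \<Longrightarrow> v = a \<or> v = b" for v using p by (auto simp: edge_point_def)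
  then show "p v \<noteq> 0 \<Longrightarrow> v \<in> carrier G" using p by blast
  show "p v \<noteq> 0 \<Longrightarrow> p v' \<noteq> 0 \<Longrightarrow> wd v v' \<le> 1"
    using sub[of v] sub[of v'] p word_dist_commute[of a b] word_dist_eq_0[of a a] word_dist_eq_0[of b b] by auto
  assume xy: "{w. p w \<noteq> 0} \<subseteq> {x, y}" "x \<noteq> y"
  show "p x + p y = 1"
  proof (cases "a = b \<or> t = 0 \<or> t = 1")
    case True
    then have "p = (\<lambda>w. of_bool (w = a)) \<or> p = (\<lambda>w. of_bool (w = b))"
      using p by (auto simp: edge_point_def fun_eq_iff)
    then show ?thesis using xy by auto
  next
    case False
    then have "p a \<noteq> 0" "p b \<noteq> 0" using p by (auto simp: edge_point_def)
    then have "(a = x \<and> b = y) \<or> (a = y \<and> b = x)" using False xy by blast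
    then show ?thesis using p False by (auto simp: edge_point_def)
  qed
qed

lemma vertex_in_cayley_graph: "x \<in> carrier G \<Longrightarrow> vertex x \<in> cayley_graph G S"
proof -
  assume x: "x \<in> carrier G"
  have "vertex x = edge_point x x 0" by (auto simp: vertex_def edge_point_def)
  then show ?thesis using x word_dist_eq_0[of x x] unfolding cayley_graph_def
    by (intro CollectI exI[of _ x] exI[of _ "0::real"]) auto
qed

lemma cayley_dist_commute:
  assumes p: "p \<in> cayley_graph G S" and q: "q \<in> cayley_graph G S"
  shows "cayley_dist G S p q = cayley_dist G S q p"
proof -
  have "{(1 - p u) + real (wd u v) + (1 - q v) | u v. p u \<noteq> 0 \<and> q v \<noteq> 0}
      = {(1 - q u) + real (wd u v) + (1 - p v) | u v. q u \<noteq> 0 \<and> p v \<noteq> 0}"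
    using word_dist_commute cayley_point_props(3)[OF p] cayley_point_props(3)[OF q]
    by (smt (verit, ccfv_threshold) Collect_cong)
  then show ?thesis unfolding cayley_dist_def by (simp add: abs_minus_commute Un_commute)
qed

lemma cayley_dist_vertex:
  assumes x: "x \<in> carrier G" and y: "y \<in> carrier G"
  shows "cayley_dist G S (vertex x) (vertex y) = real (wd x y)"
  unfolding cayley_dist_def
proof (rule cInf_eq_minimum)
  fix e assume "e \<in> {\<bar>vertex x u - vertex y u\<bar> | u v. u \<in> carrier G \<and> v \<in> carrier G \<and> wd u v \<le> 1 \<and>
             {w. vertex x w \<noteq> 0} \<union> {w. vertex y w \<noteq> 0} \<subseteq> {u, v}} \<union>
          {(1 - vertex x u) + real (wd u v) + (1 - vertex y v) | u v. vertex x u \<noteq> 0 \<and> vertex y v \<noteq> 0}"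
  then show "real (wd x y) \<le> e"
    using word_dist_commute[OF x y] word_dist_eq_0[OF x x] word_dist_eq_0[OF y y] by (auto simp: vertex_def)
qed (auto simp: vertex_def)

text \<open>
  One unit of the error replaces the infimum by an element within 1 of it. The other one is for
  the case that \<open>p\<close> lies on an edge at \<open>x\<close>, whose endpoints are within 1 of \<open>x\<close>.
\<close>
lemma cayley_dist_from_vertex:
  assumes x: "x \<in> carrier G" and p: "p \<in> cayley_graph G S" and r: "cayley_dist G S (vertex x) p \<le> r"
  shows "\<exists>v\<in>carrier G. p v \<noteq> 0 \<and> real (wd x v) \<le> r + 2"
proof -
  define T1 where "T1 = {\<bar>vertex x u - p u\<bar> | u v. u \<in> carrier G \<and> v \<in> carrier G \<and> wd u v \<le> 1 \<and>
             {w. vertex x w \<noteq> 0} \<union> {w. p w \<noteq> 0} \<subseteq> {u, v}}"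
  define T2 where "T2 = {(1 - vertex x u) + real (wd u v) + (1 - p v) | u v. vertex x u \<noteq> 0 \<and> p v \<noteq> 0}"
  obtain v0 where v0: "p v0 \<noteq> 0" using cayley_point_props(1)[OF p] by blast
  then have "T1 \<union> T2 \<noteq> {}" unfolding T2_def by (auto simp: vertex_def)
  moreover have "Inf (T1 \<union> T2) < r + 1" using r unfolding cayley_dist_def T1_def T2_def by simp
  ultimately obtain e where e: "e \<in> T1 \<union> T2" "e < r + 1" by (meson cInf_lessD)
  from e(1) show ?thesis
  proof
    assume "e \<in> T1"
    then obtain u v where uv: "u \<in> carrier G" "v \<in> carrier G" "wd u v \<le> 1" "e = \<bar>vertex x u - p u\<bar>"
      "{w. vertex x w \<noteq> 0} \<union> {w. p w \<noteq> 0} \<subseteq> {u, v}"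
      unfolding T1_def by auto
    have "x \<in> {u, v}" "v0 \<in> {u, v}" using uv(5) v0 by (auto simp: vertex_def)
    then have "wd x v0 \<le> 1"
      using uv word_dist_commute[of u v] word_dist_eq_0[of u u] word_dist_eq_0[of v v] by auto
    then show ?thesis using v0 e uv cayley_point_props(3)[OF p v0] by (intro bexI[of _ v0]) auto
  next
    assume "e \<in> T2"
    then obtain v where v: "p v \<noteq> 0" "e = real (wd x v) + (1 - p v)" unfolding T2_def by (auto simp: vertex_def)
    then show ?thesis using e cayley_point_props(2,3)[OF p, of v] by (intro bexI[of _ v]) auto
  qed
qed

text \<open>
  A coarse triangle inequality through an arbitrary point \<open>p\<close> of the Cayley graph, by which stability, a
  statement about points on edges, is brought down to vertices. Each of the two legs is rerouted
  to an endpoint of the edge of \<open>p\<close> at cost 2, and the two endpoints are within 1 of each other.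
\<close>
lemma word_dist_via_cayley_point:
  assumes x: "x \<in> carrier G" and y: "y \<in> carrier G" and p: "p \<in> cayley_graph G S"
    and r: "cayley_dist G S (vertex x) p \<le> r" and s: "cayley_dist G S (vertex y) p \<le> s"
  shows "real (wd x y) \<le> r + s + 5"
proof -
  obtain u v where uv: "u \<in> carrier G" "p u \<noteq> 0" "real (wd x u) \<le> r + 2"
    "v \<in> carrier G" "p v \<noteq> 0" "real (wd y v) \<le> s + 2"
    using cayley_dist_from_vertex[OF x p r] cayley_dist_from_vertex[OF y p s] by blast
  have "wd u v \<le> 1" using cayley_point_props(4)[OF p] uv by blast
  then show ?thesis
    using word_dist_triangle[of x u y] word_dist_triangle[of u v y] word_dist_commute[of v y] x y uv by auto
qed

text \<open>
  The path that runs along the edges through the vertices \<open>w 0, \<dots>, w n\<close> at unit speed. The minimum keeps the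
  index within range at the final time \<open>t = n\<close>, where the edge degenerates to the last vertex.
\<close>
definition edge_path :: "nat \<Rightarrow> (nat \<Rightarrow> 'a) \<Rightarrow> real \<Rightarrow> ('a \<Rightarrow> real)" where
  "edge_path n w t = edge_point (w (nat \<lfloor>t\<rfloor>)) (w (min n (Suc (nat \<lfloor>t\<rfloor>)))) (t - real (nat \<lfloor>t\<rfloor>))"

lemma edge_path_vertex: "edge_path n w (real i) = vertex (w i)"
  unfolding edge_path_def edge_point_def vertex_def by auto

context
  fixes n :: nat and w :: "nat \<Rightarrow> 'a"
  assumes w: "discrete_geodesic (carrier G) word_metric n w"
begin

lemma w_carrier: "i \<le> n \<Longrightarrow> w i \<in> carrier G"
  using discrete_geodesicD(2)[OF w] by blast

lemma w_dist: "i \<le> n \<Longrightarrow> j \<le> n \<Longrightarrow> real (wd (w i) (w j)) = \<bar>real i - real j\<bar>"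
  using discrete_geodesicD[OF w] by (simp add: restricted_dist_def)

lemma w_inj: "i \<le> n \<Longrightarrow> j \<le> n \<Longrightarrow> w i = w j \<longleftrightarrow> i = j"
  using w_dist[of i j] word_dist_eq_0[of "w i" "w j"] w_carrier by force

lemma edge_path_cases:
  assumes "t \<in> {0..real n}"
  obtains k where "edge_path n w t = edge_point (w k) (w (min n (Suc k))) (t - real k)"
    "k \<le> n" "real k \<le> t" "t < real k + 1"
proof -
  have "nat \<lfloor>t\<rfloor> \<le> n" "real (nat \<lfloor>t\<rfloor>) \<le> t" "t < real (nat \<lfloor>t\<rfloor>) + 1"
    using assms by (auto simp: nat_le_iff floor_le_iff)
  then show thesis using that unfolding edge_path_def by blast
qed

lemma edge_path_in_cayley_graph:
  assumes t: "t \<in> {0..real n}"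
  shows "edge_path n w t \<in> cayley_graph G S"
proof -
  obtain k where k: "edge_path n w t = edge_point (w k) (w (min n (Suc k))) (t - real k)"
    "k \<le> n" "real k \<le> t" "t < real k + 1" using edge_path_cases[OF t] .
  have "real (wd (w k) (w (min n (Suc k)))) \<le> 1" using w_dist[of k "min n (Suc k)"] k(2) by (auto simp: min_def)
  then show ?thesis
    unfolding cayley_graph_def k(1)
    by (intro CollectI exI[of _ "w k"] exI[of _ "w (min n (Suc k))"] exI[of _ "t - real k"]) (use k w_carrier in auto)
qed

text \<open>
  Along the path, each barycentric coordinate is a tent function of time, because the vertices of a
  geodesic are distinct. All distances between points of the path are read off from this formula.
\<close>
lemma edge_path_coordinate:
  assumes t: "t \<in> {0..real n}" and i: "i \<le> n"
  shows "edge_path n w t (w i) = max 0 (1 - \<bar>t - real i\<bar>)"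
proof -
  obtain k where k: "edge_path n w t = edge_point (w k) (w (min n (Suc k))) (t - real k)"
    "k \<le> n" "real k \<le> t" "t < real k + 1" using edge_path_cases[OF t] .
  have e: "edge_path n w t (w i) = (1 - (t - k)) * of_bool (i = k) + (t - k) * of_bool (i = min n (Suc k))"
    unfolding k(1) edge_point_def using w_inj i k by simp
  show ?thesis
  proof (cases "k = n")
    case True
    then have "t = n" using t k by auto
    then show ?thesis unfolding e using True i by (auto simp: max_def)
  next
    case False
    then have m: "min n (Suc k) = Suc k" using k by auto
    consider "i < k" | "i = k" | "i = Suc k" | "i > Suc k" by linarith
    then show ?thesis unfolding e m using k by cases (auto simp: max_def)
  qed
qed

lemma edge_path_support:
  assumes t: "t \<in> {0..real n}" and v: "edge_path n w t v \<noteq> 0"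
  shows "\<exists>i\<le>n. v = w i"
proof -
  obtain k where k: "edge_path n w t = edge_point (w k) (w (min n (Suc k))) (t - real k)" "k \<le> n"
    using edge_path_cases[OF t] by metis
  have "v = w k \<or> v = w (min n (Suc k))"
    using v unfolding k(1) edge_point_def by auto
  then show ?thesis using k(2) by (metis min.cobounded1)
qed

text \<open>
  Every competitor in the infimum that defines the distance is at least \<open>t - s\<close>, and one of them
  is equal to it: the common edge if there is one, otherwise the route along the path itself.
\<close>
lemma cayley_dist_edge_path:
  assumes s: "s \<in> {0..real n}" and t: "t \<in> {0..real n}" and st: "s \<le> t"
  shows "cayley_dist G S (edge_path n w s) (edge_path n w t) = t - s"
  unfolding cayley_dist_def
proof (rule cInf_eq_minimum)
  let ?p = "edge_path n w s" and ?q = "edge_path n w t"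
  let ?T1 = "{\<bar>?p u - ?q u\<bar> | u v. u \<in> carrier G \<and> v \<in> carrier G \<and> wd u v \<le> 1 \<and>
             {w. ?p w \<noteq> 0} \<union> {w. ?q w \<noteq> 0} \<subseteq> {u, v}}"
  let ?T2 = "{(1 - ?p u) + real (wd u v) + (1 - ?q v) | u v. ?p u \<noteq> 0 \<and> ?q v \<noteq> 0}"
  note co = edge_path_coordinate[OF s] edge_path_coordinate[OF t]
  obtain i where i: "?p = edge_point (w i) (w (min n (Suc i))) (s - real i)"
    "i \<le> n" "real i \<le> s" "s < real i + 1" using edge_path_cases[OF s] .
  obtain j where j: "?q = edge_point (w j) (w (min n (Suc j))) (t - real j)"
    "j \<le> n" "real j \<le> t" "t < real j + 1" using edge_path_cases[OF t] .
  have ij: "i \<le> j" using i j st by linarith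
  have pi: "?p (w i) = 1 - (s - i)" and qj: "?q (w j) = 1 - (t - j)" using co(1)[of i] co(2)[of j] i(2-4) j(2-4) by (auto simp: max_def)
  show "t - s \<in> ?T1 \<union> ?T2"
  proof (cases "i = j")
    case True
    let ?v = "w (min n (Suc i))"
    have "{w. ?p w \<noteq> 0} \<union> {w. ?q w \<noteq> 0} \<subseteq> {w i, ?v}"
      using True unfolding i(1) j(1) edge_point_def by auto
    moreover have "real (wd (w i) ?v) \<le> 1" using w_dist[of i "min n (Suc i)"] i by auto
    moreover have "t - s = \<bar>?p (w i) - ?q (w i)\<bar>" using pi qj True st by auto
    ultimately have "t - s \<in> ?T1" using w_carrier i
      by (intro CollectI exI[of _ "w i"] exI[of _ ?v]) auto
    then show ?thesis by blast
  next
    case False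
    \<comment> \<open>The path leaves the edge of \<open>s\<close> at its first vertex after \<open>s\<close>, which is \<open>s\<close> itself
      if \<open>s\<close> is an integer.\<close>
    define k where "k = (if s = i then i else Suc i)"
    have k: "k \<le> j" "s \<le> k" "k < s + 1" using ij False i unfolding k_def by auto
    have "?p (w k) = 1 - (k - s)" using co(1)[of k] k j by auto
    moreover have "real (wd (w k) (w j)) = real j - real k" using w_dist[of k j] k j by auto
    ultimately have "t - s \<in> ?T2" using qj k j by (intro CollectI exI[of _ "w k"] exI[of _ "w j"]) auto
    then show ?thesis by blast
  qed
  fix e assume "e \<in> ?T1 \<union> ?T2"
  then show "t - s \<le> e"
  proof
    assume "e \<in> ?T1"
    then obtain u v where uv: "u \<in> carrier G" "v \<in> carrier G" "wd u v \<le> 1" "e = \<bar>?p u - ?q u\<bar>"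
      "{w. ?p w \<noteq> 0} \<union> {w. ?q w \<noteq> 0} \<subseteq> {u, v}" by auto
    have supp: "x \<in> {u, v}" if "?p x \<noteq> 0 \<or> ?q x \<noteq> 0" for x using uv(5) that by blast
    have wi: "w i \<in> {u, v}" and wj: "w j \<in> {u, v}"
      using supp[of "w i"] supp[of "w j"] pi qj i(4) j(4) by auto
    have next_s: "w (Suc i) \<in> {u, v} \<and> Suc i \<le> n" if "s \<noteq> i"
    proof -
      have "Suc i \<le> n" using that s i(2-4) by auto
      moreover from this have "?p (w (Suc i)) \<noteq> 0" using co(1)[of "Suc i"] that i(2-4) by (simp add: max_def)
      ultimately show ?thesis using supp by blast
    qed
    have next_t: "w (Suc j) \<in> {u, v} \<and> Suc j \<le> n" if "t \<noteq> j"
    proof -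
      have "Suc j \<le> n" using that t j(2-4) by auto
      moreover from this have "?q (w (Suc j)) \<noteq> 0" using co(2)[of "Suc j"] that j(2-4) by (simp add: max_def)
      ultimately show ?thesis using supp by blast
    qed
    have "real (wd (w i) (w j)) \<le> 1"
      using wi wj uv word_dist_commute[of u v] word_dist_eq_0[of u u] word_dist_eq_0[of v v] by auto
    then have ij1: "j \<le> Suc i" using w_dist[of i j] i j ij by auto
    have near: "t \<le> i + 1"
    proof (rule ccontr)
      assume "\<not> t \<le> i + 1"
      then have "j = Suc i" "t \<noteq> j" using ij1 j by auto
      then show False using next_t wi wj w_inj[of i j] w_inj[of i "Suc j"] w_inj[of j "Suc j"] j i by auto
    qed
    show ?thesis
    proof (cases "u = v")
      case True
      then have eq: "w i = u" "w j = u" using wi wj by auto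
      have "s = i"
        using next_s w_inj[OF i(2), of "Suc i"] eq True by (metis empty_iff insert_iff n_not_Suc_n)
      moreover have "t = j"
        using next_t w_inj[OF j(2), of "Suc j"] eq True by (metis empty_iff insert_iff n_not_Suc_n)
      moreover have "i = j" using w_inj[OF i(2) j(2)] eq by simp
      ultimately show ?thesis using uv(4) True by simp
    next
      case False
      have "?p u + ?p v = 1" "?q u + ?q v = 1"
        using cayley_point_props(5)[OF edge_path_in_cayley_graph[OF s]]
          cayley_point_props(5)[OF edge_path_in_cayley_graph[OF t]] uv False by auto
      then have "e = \<bar>?p (w i) - ?q (w i)\<bar>" using uv wi by auto
      moreover have "?q (w i) = 1 - (t - i)" using co(2)[of i] i near st by auto
      ultimately show ?thesis using pi by auto
    qed
  next
    assume "e \<in> ?T2"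
    then obtain u v where uv: "e = (1 - ?p u) + real (wd u v) + (1 - ?q v)" "?p u \<noteq> 0" "?q v \<noteq> 0" by auto
    obtain k l where kl: "k \<le> n" "u = w k" "l \<le> n" "v = w l"
      using edge_path_support[OF s uv(2)] edge_path_support[OF t uv(3)] by blast
    have "1 - ?p u = \<bar>s - k\<bar>" "1 - ?q v = \<bar>t - l\<bar>" using co(1)[OF kl(1)] co(2)[OF kl(3)] uv(2,3) kl(2,4) by (auto simp: max_def split: if_splits)
    then show ?thesis using uv(1) w_dist[of k l] kl by auto
  qed
qed

lemma geodesic_edge_path: "geodesic (cayley_graph G S) (cayley_dist G S) {0..real n} (edge_path n w)"
  unfolding geodesic_def
proof (intro conjI ballI)
  fix s t assume s: "s \<in> {0..real n}" and t: "t \<in> {0..real n}"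
  show "cayley_dist G S (edge_path n w s) (edge_path n w t) = dist s t"
    using cayley_dist_edge_path[OF s t] cayley_dist_edge_path[OF t s]
      cayley_dist_commute[OF edge_path_in_cayley_graph[OF s] edge_path_in_cayley_graph[OF t]]
    by (cases "s \<le> t") (auto simp: dist_real_def)
qed (use edge_path_in_cayley_graph in auto)

end

lemma quasigeodesic_of_discrete:
  assumes \<eta>: "discrete_quasigeodesic (carrier G) word_metric L n \<eta>" and L: "L \<ge> 1"
  shows "quasigeodesic (cayley_graph G S) (cayley_dist G S) L (2 * L) {0..real n} (\<lambda>t. vertex (\<eta> (nat \<lfloor>t\<rfloor>)))"
proof -
  have fl: "nat \<lfloor>t\<rfloor> \<le> n" "real (nat \<lfloor>t\<rfloor>) \<le> t" "t < real (nat \<lfloor>t\<rfloor>) + 1" if "t \<in> {0..real n}" for t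
    using that by (auto simp: nat_le_iff floor_le_iff)
  have \<eta>M: "\<eta> (nat \<lfloor>t\<rfloor>) \<in> carrier G" if "t \<in> {0..real n}" for t
    using fl[OF that] \<eta> unfolding discrete_quasigeodesic_def by auto
  have "dist s t / L - 2 * L \<le> cayley_dist G S (vertex (\<eta> (nat \<lfloor>s\<rfloor>))) (vertex (\<eta> (nat \<lfloor>t\<rfloor>)))
      \<and> cayley_dist G S (vertex (\<eta> (nat \<lfloor>s\<rfloor>))) (vertex (\<eta> (nat \<lfloor>t\<rfloor>))) \<le> L * dist s t + 2 * L"
    if s: "s \<in> {0..real n}" and t: "t \<in> {0..real n}" for s t
  proof -
    let ?i = "nat \<lfloor>s\<rfloor>" and ?j = "nat \<lfloor>t\<rfloor>"
    let ?r = "\<bar>real ?i - real ?j\<bar>"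
    have r: "dist s t \<le> ?r + 1" "?r \<le> dist s t + 1"
      using fl(2,3)[OF s] fl(2,3)[OF t] unfolding dist_real_def by linarith+
    have "?r / L - L \<le> word_metric (\<eta> ?i) (\<eta> ?j)" "word_metric (\<eta> ?i) (\<eta> ?j) \<le> L * ?r + L"
      using \<eta>[unfolded discrete_quasigeodesic_def, THEN conjunct2, rule_format, OF fl(1)[OF s] fl(1)[OF t]]
      by (rule conjunct1, rule conjunct2)
    moreover have "cayley_dist G S (vertex (\<eta> ?i)) (vertex (\<eta> ?j)) = word_metric (\<eta> ?i) (\<eta> ?j)"
      using cayley_dist_vertex[OF \<eta>M[OF s] \<eta>M[OF t]] \<eta>M[OF s] \<eta>M[OF t] by (simp add: restricted_dist_def)
    moreover have "dist s t / L \<le> ?r / L + L"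
    proof -
      have "dist s t / L \<le> (?r + 1) / L" using r L by (intro divide_right_mono) auto
      also have "\<dots> = ?r / L + 1 / L" by (simp add: add_divide_distrib)
      also have "1 / L \<le> L" using L by (simp add: field_simps) (metis mult_mono' mult_1 zero_le_one)
      finally show ?thesis by simp
    qed
    moreover have "L * ?r \<le> L * dist s t + L"
      using mult_left_mono[OF r(2), of L] L by (simp add: algebra_simps)
    ultimately show ?thesis by linarith
  qed
  then show ?thesis
    unfolding quasigeodesic_def qi_embedding_def using \<eta>M vertex_in_cayley_graph by auto
qed

end

section \<open>Cosets of stable subgroups\<close>

abbreviation subgroup_metric :: "('a, 'b) monoid_scheme \<Rightarrow> 'a set \<Rightarrow> 'a set \<Rightarrow> 'a \<Rightarrow> 'a \<Rightarrow> real" where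
  "subgroup_metric G H T \<equiv> restricted_dist H (word_dist (G\<lparr>carrier := H\<rparr>) T)"

definition coset_metric :: "('a, 'b) monoid_scheme \<Rightarrow> 'a set \<Rightarrow> 'a set \<Rightarrow> 'a \<Rightarrow> 'a \<Rightarrow> 'a \<Rightarrow> real" where
  "coset_metric G H T g =
     restricted_dist (g <#\<^bsub>G\<^esub> H) (\<lambda>x y. word_dist (G\<lparr>carrier := H\<rparr>) T (inv\<^bsub>G\<^esub> g \<otimes>\<^bsub>G\<^esub> x) (inv\<^bsub>G\<^esub> g \<otimes>\<^bsub>G\<^esub> y))"

lemma stable_quasigeodesicD:
  assumes "stable_quasigeodesic X d f I \<gamma>" and "quasigeodesic X d K \<epsilon> {a..b} \<eta>"
    and "K \<ge> 1" "\<epsilon> \<ge> 0" "a \<le> b" "\<eta> a \<in> \<gamma> ` I" "\<eta> b \<in> \<gamma> ` I" "s \<in> {a..b}"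
  shows "\<exists>t\<in>I. d (\<eta> s) (\<gamma> t) \<le> f K \<epsilon>"
  using assms unfolding stable_quasigeodesic_def by blast

context generated_group
begin

text \<open>
  Discrete geodesics of \<open>H\<close> are filled in to geodesics of the Cayley graph of \<open>H\<close>, and discrete
  quasigeodesics of \<open>G\<close> are read as step functions into the Cayley graph of \<open>G\<close>, so that the
  definition of stability applies. The point it yields lies on an edge; rounding its time down to
  an integer changes it by a bounded amount, because \<open>\<phi>\<close> is a quasi-isometric embedding.
\<close>
lemma stable_subgroup_stably_embedded:
  assumes "stable_subgroup G S H"
  obtains T K \<mu> where "K \<ge> 1" "stably_embedded (carrier G) word_metric K \<mu> H (subgroup_metric G H T)"
proof -
  let ?H = "G\<lparr>carrier := H\<rparr>"
  obtain T \<phi> f K \<epsilon> where sub: "subgroup H G" and T: "finite_generating_set ?H T"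
    and \<phi>: "\<And>h. h \<in> H \<Longrightarrow> \<phi> (vertex h) = vertex h"
    and K: "K \<ge> 1" and \<epsilon>: "\<epsilon> \<ge> 0"
    and qi: "qi_embedding (cayley_graph ?H T) (cayley_dist ?H T) (cayley_graph G S) (cayley_dist G S) K \<epsilon> \<phi>"
    and st: "\<And>I \<gamma>. geodesic (cayley_graph ?H T) (cayley_dist ?H T) I \<gamma> \<Longrightarrow>
           stable_quasigeodesic (cayley_graph G S) (cayley_dist G S) f I (\<phi> \<circ> \<gamma>)"
    using assms unfolding stable_subgroup_def by blast
  interpret H: generated_group ?H T
    using subgroup.subgroup_is_group[OF sub is_group] T
    by (intro generated_group.intro generated_group_axioms.intro)
  have HG: "H \<subseteq> carrier G" using subgroup.subset[OF sub] .
  let ?dH = "subgroup_metric G H T"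
  let ?K = "K * (1 + \<epsilon>)"
  have K': "?K \<ge> 1" "K \<le> ?K" "\<epsilon> \<le> ?K" "K * \<epsilon> \<le> ?K"
    using K \<epsilon> mult_mono[of 1 K 1 "1 + \<epsilon>"] mult_right_mono[of 1 K \<epsilon>] by (auto simp: algebra_simps)
  have bounds: "word_metric x y \<le> ?K * ?dH x y + ?K \<and> ?dH x y \<le> ?K * word_metric x y + ?K"
    if x: "x \<in> H" and y: "y \<in> H" for x y
  proof -
    let ?a = "real (wd x y)" and ?b = "real (word_dist ?H T x y)"
    have v: "vertex x \<in> cayley_graph ?H T" "vertex y \<in> cayley_graph ?H T"
      using H.vertex_in_cayley_graph x y by auto
    have xyG: "x \<in> carrier G" "y \<in> carrier G" using x y HG by auto
    have b: "?b / K - \<epsilon> \<le> ?a" "?a \<le> K * ?b + \<epsilon>"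
      using qi v \<phi>[OF x] \<phi>[OF y] cayley_dist_vertex[OF xyG] H.cayley_dist_vertex x y
      unfolding qi_embedding_def by force+
    then have "?b \<le> K * ?a + K * \<epsilon>" using K by (simp add: field_simps)
    moreover have "K * ?a \<le> ?K * ?a" "K * ?b \<le> ?K * ?b" using K' by (intro mult_right_mono; simp)+
    ultimately show ?thesis using b K' x y xyG by (auto simp: restricted_dist_def)
  qed
  define \<mu> where "\<mu> L = f L (2 * L) + (K + \<epsilon>) + 5" for L
  have mor: "morse (carrier G) word_metric \<mu> (w ` {..n})"
    if w: "discrete_geodesic H ?dH n w" for n w
    unfolding morse_def
  proof (intro conjI allI impI)
    have wH: "w i \<in> H" if "i \<le> n" for i using discrete_geodesicD(2)[OF w that that] .
    then show "w ` {..n} \<subseteq> carrier G" using HG by auto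
    fix L :: real and m \<eta> i
    assume L: "L \<ge> 1" and i: "i \<le> m"
      and \<eta>: "discrete_quasigeodesic (carrier G) word_metric L m \<eta> \<and> \<eta> 0 \<in> w ` {..n} \<and> \<eta> m \<in> w ` {..n}"
    have w': "discrete_geodesic (carrier ?H) H.word_metric n w" using w by simp
    let ?\<gamma> = "H.edge_path n w" and ?\<eta> = "\<lambda>t::real. vertex (\<eta> (nat \<lfloor>t\<rfloor>))"
    have stab: "stable_quasigeodesic (cayley_graph G S) (cayley_dist G S) f {0..real n} (\<phi> \<circ> ?\<gamma>)"
      by (rule st[OF H.geodesic_edge_path[OF w']])
    have \<eta>_qi: "quasigeodesic (cayley_graph G S) (cayley_dist G S) L (2 * L) {0..real m} ?\<eta>"
      using quasigeodesic_of_discrete \<eta> L by blast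
    have ends: "vertex (w k) \<in> (\<phi> \<circ> ?\<gamma>) ` {0..real n}" if "k \<le> n" for k
      using that H.edge_path_vertex[of n w k] \<phi>[OF wH[OF that]] by (intro image_eqI[of _ _ "real k"]) auto
    have "?\<eta> 0 \<in> (\<phi> \<circ> ?\<gamma>) ` {0..real n}" "?\<eta> (real m) \<in> (\<phi> \<circ> ?\<gamma>) ` {0..real n}"
      using \<eta> ends by auto
    then have "\<exists>t\<in>{0..real n}. cayley_dist G S (?\<eta> (real i)) ((\<phi> \<circ> ?\<gamma>) t) \<le> f L (2 * L)"
      using L i by (intro stable_quasigeodesicD[OF stab \<eta>_qi]) auto
    then obtain t where t: "t \<in> {0..real n}" "cayley_dist G S (?\<eta> (real i)) ((\<phi> \<circ> ?\<gamma>) t) \<le> f L (2 * L)"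
      by blast
    let ?k = "nat \<lfloor>t\<rfloor>"
    have k: "?k \<le> n" "real ?k \<le> t" "t < real ?k + 1" using t by (auto simp: nat_le_iff floor_le_iff)
    have \<gamma>: "?\<gamma> t \<in> cayley_graph ?H T" "?\<gamma> (real ?k) \<in> cayley_graph ?H T"
      using H.edge_path_in_cayley_graph[OF w'] t k by auto
    have "cayley_dist ?H T (?\<gamma> (real ?k)) (?\<gamma> t) = t - real ?k"
      by (rule H.cayley_dist_edge_path[OF w']) (use t k in auto)
    then have "cayley_dist ?H T (?\<gamma> (real ?k)) (?\<gamma> t) \<le> 1" using k(3) by linarith
    then have "K * cayley_dist ?H T (?\<gamma> (real ?k)) (?\<gamma> t) \<le> K" using K by (simp add: mult_left_le)
    then have "cayley_dist G S (\<phi> (?\<gamma> (real ?k))) (\<phi> (?\<gamma> t)) \<le> K + \<epsilon>"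
      using qi \<gamma> unfolding qi_embedding_def by fastforce
    then have d2: "cayley_dist G S (vertex (w ?k)) (\<phi> (?\<gamma> t)) \<le> K + \<epsilon>"
      using H.edge_path_vertex[of n w ?k] \<phi>[OF wH[OF k(1)]] by simp
    have "\<eta> i \<in> carrier G" using \<eta> i unfolding discrete_quasigeodesic_def by auto
    moreover have "w ?k \<in> carrier G" using wH[OF k(1)] HG by auto
    moreover have "\<phi> (?\<gamma> t) \<in> cayley_graph G S" using qi \<gamma> unfolding qi_embedding_def by auto
    ultimately have "word_metric (\<eta> i) (w ?k) \<le> \<mu> L"
      using word_dist_via_cayley_point[OF _ _ _ _ d2, of "\<eta> i" "f L (2 * L)"] t
      unfolding \<mu>_def restricted_dist_def by simp
    then show "near word_metric (\<mu> L) (w ` {..n}) (\<eta> i)" using k(1) unfolding near_def by blast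
  qed
  have "stably_embedded (carrier G) word_metric ?K \<mu> H ?dH"
    unfolding stably_embedded_def
    using HG H.Metric_space_word_metric H.discretely_geodesic_word_metric bounds mor by auto
  then show thesis using that K' by blast
qed

lemma mult_inv_cancel: "g \<in> carrier G \<Longrightarrow> x \<in> carrier G \<Longrightarrow> g \<otimes> (inv g \<otimes> x) = x"
  and inv_mult_cancel: "g \<in> carrier G \<Longrightarrow> x \<in> carrier G \<Longrightarrow> inv g \<otimes> (g \<otimes> x) = x"
  by (simp_all add: m_assoc[symmetric])

lemma in_l_coset_iff:
  assumes "g \<in> carrier G" "H \<subseteq> carrier G" "x \<in> carrier G"
  shows "x \<in> g <# H \<longleftrightarrow> inv g \<otimes> x \<in> H"
proof
  show "x \<in> g <# H \<Longrightarrow> inv g \<otimes> x \<in> H" using assms inv_mult_cancel unfolding l_coset_def by fastforce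
  show "inv g \<otimes> x \<in> H \<Longrightarrow> x \<in> g <# H" 
    using assms mult_inv_cancel[of g x] unfolding l_coset_def by (intro UN_I[of "inv g \<otimes> x"]) auto
qed

lemma word_metric_left_invariant:
  "g \<in> carrier G \<Longrightarrow> x \<in> carrier G \<Longrightarrow> y \<in> carrier G \<Longrightarrow> word_metric (g \<otimes> x) (g \<otimes> y) = word_metric x y"
  using word_dist_left_invariant by (simp add: restricted_dist_def)

lemma morse_translate:
  assumes P: "morse (carrier G) word_metric \<mu> ((\<lambda>x. inv g \<otimes> x) ` P)" and g: "g \<in> carrier G" and PG: "P \<subseteq> carrier G"
  shows "morse (carrier G) word_metric \<mu> P"
  unfolding morse_def
proof (intro conjI allI impI)
  fix L :: real and n \<eta> i
  assume L: "L \<ge> 1" and i: "i \<le> n"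
    and \<eta>: "discrete_quasigeodesic (carrier G) word_metric L n \<eta> \<and> \<eta> 0 \<in> P \<and> \<eta> n \<in> P"
  have \<eta>G: "\<eta> j \<in> carrier G" if "j \<le> n" for j using \<eta> that unfolding discrete_quasigeodesic_def by auto
  have "discrete_quasigeodesic (carrier G) word_metric L n (\<lambda>i. inv g \<otimes> \<eta> i)"
    using \<eta> \<eta>G g word_metric_left_invariant[of "inv g"] unfolding discrete_quasigeodesic_def by simp
  then have "near word_metric (\<mu> L) ((\<lambda>x. inv g \<otimes> x) ` P) (inv g \<otimes> \<eta> i)"
    using P L i \<eta> unfolding morse_def by blast
  then obtain p where "p \<in> P" "word_metric (inv g \<otimes> \<eta> i) (inv g \<otimes> p) \<le> \<mu> L" unfolding near_def by blast
  then show "near word_metric (\<mu> L) P (\<eta> i)"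
    using word_metric_left_invariant[of "inv g" "\<eta> i" p] g \<eta>G[OF i] PG
    unfolding near_def by (intro bexI[of _ p]) auto
qed (use PG in auto)

lemma coset_stably_embedded:
  assumes H: "stably_embedded (carrier G) word_metric K \<mu> H (subgroup_metric G H T)" and g: "g \<in> carrier G"
  shows "stably_embedded (carrier G) word_metric K \<mu> (g <# H) (coset_metric G H T g)"
proof -
  let ?A = "g <# H" and ?dH = "subgroup_metric G H T" and ?dA = "coset_metric G H T g"
  let ?t = "\<lambda>x. inv g \<otimes> x"
  have HG: "H \<subseteq> carrier G" using H unfolding stably_embedded_def by blast
  then have AG: "?A \<subseteq> carrier G" using g unfolding l_coset_def by auto
  interpret H: Metric_space H ?dH using H unfolding stably_embedded_def by blast
  have tH: "?t x \<in> H" if "x \<in> ?A" for x using that in_l_coset_iff[OF g HG] AG by auto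
  have dA: "?dA x y = ?dH (?t x) (?t y)" if "x \<in> ?A" "y \<in> ?A" for x y
    using that tH unfolding coset_metric_def restricted_dist_def by auto
  have inj: "?t x = ?t y \<longleftrightarrow> x = y" if "x \<in> ?A" "y \<in> ?A" for x y
    using that AG g by (metis mult_inv_cancel subsetD)
  have met: "Metric_space ?A ?dA"
  proof
    show "?dA x y = ?dA y x" for x y
      using dA[of x y] dA[of y x] H.commute[of "?t x" "?t y"]
      by (cases "x \<in> ?A \<and> y \<in> ?A") (auto simp: coset_metric_def restricted_dist_def)
  qed (use dA tH inj H.zero H.triangle in \<open>auto simp: coset_metric_def restricted_dist_def\<close>)
  have geo: "discretely_geodesic ?A ?dA"
    unfolding discretely_geodesic_def
  proof (intro ballI)
    fix x y assume x: "x \<in> ?A" and y: "y \<in> ?A"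
    obtain n w where w: "discrete_geodesic H ?dH n w" "w 0 = ?t x" "w n = ?t y"
      using H tH[OF x] tH[OF y] unfolding stably_embedded_def discretely_geodesic_def by meson
    have wA: "g \<otimes> w i \<in> ?A" if "i \<le> n" for i
      using discrete_geodesicD(2)[OF w(1) that that] unfolding l_coset_def by auto
    have tw: "?t (g \<otimes> w i) = w i" if "i \<le> n" for i
      using discrete_geodesicD(2)[OF w(1) that that] HG g inv_mult_cancel by auto
    have "discrete_geodesic ?A ?dA n (\<lambda>i. g \<otimes> w i)"
      unfolding discrete_geodesic_def using wA by (simp add: Pi_iff dA tw discrete_geodesicD(1)[OF w(1)])
    moreover have "g \<otimes> w 0 = x" "g \<otimes> w n = y" using w x y AG g mult_inv_cancel by auto
    ultimately show "\<exists>n w. discrete_geodesic ?A ?dA n w \<and> w 0 = x \<and> w n = y" by blast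
  qed
  have mor: "morse (carrier G) word_metric \<mu> (w ` {..n})" if w: "discrete_geodesic ?A ?dA n w" for n w
  proof (rule morse_translate[OF _ g])
    have wA: "w i \<in> ?A" if "i \<le> n" for i using discrete_geodesicD(2)[OF w that that] .
    then show "w ` {..n} \<subseteq> carrier G" using AG by auto
    have "discrete_geodesic H ?dH n (\<lambda>i. ?t (w i))"
      unfolding discrete_geodesic_def
      using wA tH by (simp add: Pi_iff dA[symmetric] discrete_geodesicD(1)[OF w])
    then have "morse (carrier G) word_metric \<mu> ((\<lambda>i. ?t (w i)) ` {..n})"
      using H unfolding stably_embedded_def by blast
    then show "morse (carrier G) word_metric \<mu> (?t ` w ` {..n})" by (simp add: image_image)
  qed
  have "word_metric x y \<le> K * ?dA x y + K \<and> ?dA x y \<le> K * word_metric x y + K"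
    if x: "x \<in> ?A" and y: "y \<in> ?A" for x y
  proof -
    have "x \<in> carrier G" "y \<in> carrier G" using x y AG by auto
    then have "word_metric (?t x) (?t y) = word_metric x y" using word_metric_left_invariant g by simp
    moreover have "\<forall>x\<in>H. \<forall>y\<in>H. word_metric x y \<le> K * ?dH x y + K \<and> ?dH x y \<le> K * word_metric x y + K"
      using H unfolding stably_embedded_def by blast
    ultimately show ?thesis using tH[OF x] tH[OF y] dA[OF x y] by metis
  qed
  then show ?thesis using met geo mor AG unfolding stably_embedded_def by blast
qed

end

lemma stably_embedded_mono:
  assumes A: "stably_embedded X d K \<mu> A dA" and K: "K \<le> K'" and \<mu>: "\<And>L. \<mu> L \<le> \<mu>' L"
    and X: "Metric_space X d"
  shows "stably_embedded X d K' \<mu>' A dA"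
proof -
  interpret Metric_space X d by fact
  interpret A: Metric_space A dA using A unfolding stably_embedded_def by blast
  have "d x y \<le> K' * dA x y + K'" "dA x y \<le> K' * d x y + K'" if "x \<in> A" "y \<in> A" for x y
  proof -
    have "K * dA x y \<le> K' * dA x y" "K * d x y \<le> K' * d x y" using K by (simp_all add: mult_right_mono)
    moreover have "d x y \<le> K * dA x y + K" "dA x y \<le> K * d x y + K"
      using A that unfolding stably_embedded_def by blast+
    ultimately show "d x y \<le> K' * dA x y + K'" "dA x y \<le> K' * d x y + K'" using K by linarith+
  qed
  moreover have "morse X d \<mu>' P" if "morse X d \<mu> P" for P using morse_mono[OF that \<mu>] .
  ultimately show ?thesis using A unfolding stably_embedded_def by blast
qed

context generated_group
begin

lemma uniform_stably_embedded:
  assumes fin: "finite \<H>" and stab: "\<And>H. H \<in> \<H> \<Longrightarrow> stable_subgroup G S H"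
  obtains K \<mu> T where "K \<ge> 1"
    "\<And>H. H \<in> \<H> \<Longrightarrow> stably_embedded (carrier G) word_metric K \<mu> H (subgroup_metric G H (T H))"
proof -
  have "\<forall>H\<in>\<H>. \<exists>T K \<mu>. K \<ge> 1 \<and> stably_embedded (carrier G) word_metric K \<mu> H (subgroup_metric G H T)"
    using stable_subgroup_stably_embedded stab by metis
  then obtain T K \<mu> where *: "\<And>H. H \<in> \<H> \<Longrightarrow> K H \<ge> 1"
    "\<And>H. H \<in> \<H> \<Longrightarrow> stably_embedded (carrier G) word_metric (K H) (\<mu> H) H (subgroup_metric G H (T H))"
    by metis
  let ?K = "1 + (\<Sum>H\<in>\<H>. \<bar>K H\<bar>)" and ?\<mu> = "\<lambda>L. \<Sum>H\<in>\<H>. \<bar>\<mu> H L\<bar>"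
  have le: "h H \<le> (\<Sum>H\<in>\<H>. \<bar>h H\<bar>)" if "H \<in> \<H>" for h :: "'a set \<Rightarrow> real" and H
    using member_le_sum[of H \<H> "\<lambda>H. \<bar>h H\<bar>"] that fin by auto
  show thesis
  proof (rule that[of ?K ?\<mu> T])
    show "?K \<ge> 1" by (simp add: sum_nonneg)
    show "stably_embedded (carrier G) word_metric ?K ?\<mu> H (subgroup_metric G H (T H))" if H: "H \<in> \<H>" for H
    proof (rule stably_embedded_mono[OF *(2)[OF H] _ _ Metric_space_word_metric])
      show "K H \<le> ?K" using le[OF H, of K] by simp
      show "\<mu> H L \<le> ?\<mu> L" for L using le[OF H, of "\<lambda>H. \<mu> H L"] .
    qed
  qed
qed

lemma close_imp_near:
  assumes A: "A \<subseteq> carrier G" "A \<noteq> {}" and B: "B \<subseteq> carrier G" "B \<noteq> {}" and close: "close G S D A B"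
  shows "\<exists>a\<in>A. near word_metric D B a"
proof -
  have "\<exists>n. \<exists>a\<in>A. \<exists>b\<in>B. n = wd a b" using A B by blast
  then have "\<exists>a\<in>A. \<exists>b\<in>B. min_dist G S A B = wd a b" unfolding min_dist_def by (rule LeastI_ex)
  then obtain a b where "a \<in> A" "b \<in> B" "min_dist G S A B = wd a b" by blast
  then show ?thesis
    using close A B unfolding close_def near_def restricted_dist_def by (intro bexI[of _ a] bexI[of _ b]) auto
qed

text \<open>
  A coset is determined by any of its elements together with the subgroup.
\<close>
lemma card_cosets_meeting_ball:
  assumes fin: "finite \<H>" and sub: "\<And>H. H \<in> \<H> \<Longrightarrow> subgroup H G" and x: "x \<in> carrier G"
    and \<F>: "\<And>C. C \<in> \<F> \<Longrightarrow> \<exists>g\<in>carrier G. \<exists>H\<in>\<H>. C = g <# H"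
    and meet: "\<And>C. C \<in> \<F> \<Longrightarrow> word_ball G S R x \<inter> C \<noteq> {}"
  shows "finite \<F> \<and> card \<F> \<le> card ({g \<in> carrier G. real (word_length G S g) \<le> R} \<times> \<H>)"
proof -
  let ?I = "{g \<in> carrier G. real (word_length G S g) \<le> R} \<times> \<H>"
  let ?c = "\<lambda>(b, H). (x \<otimes> b) <# H"
  have "\<F> \<subseteq> ?c ` ?I"
  proof
    fix C assume C: "C \<in> \<F>"
    obtain g H where gH: "g \<in> carrier G" "H \<in> \<H>" "C = g <# H" using \<F>[OF C] by blast
    obtain y where y: "y \<in> C" "y \<in> carrier G" "real (wd x y) \<le> R"
      using meet[OF C] unfolding word_ball_def by blast
    have "C = ?c (inv x \<otimes> y, H)"
      using l_repr_independence[OF _ gH(1) sub[OF gH(2)]] y gH mult_inv_cancel[OF x y(2)] by simp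
    moreover have "(inv x \<otimes> y, H) \<in> ?I" using x y gH unfolding word_dist_def by auto
    ultimately show "C \<in> ?c ` ?I" by blast
  qed
  moreover have fin_I: "finite ?I" using finite_word_ball fin by blast
  ultimately show ?thesis
    using finite_subset[of \<F> "?c ` ?I"] card_mono[of "?c ` ?I" \<F>] card_image_le[OF fin_I, of ?c] by auto
qed

end

section \<open>Pairwise close cosets\<close>

context generated_group
begin

lemma finite_family_common_ball:
  assumes K: "K \<ge> 1" and D: "D \<ge> 0"
    and stab: "\<And>H. H \<in> \<H> \<Longrightarrow> stably_embedded (carrier G) word_metric K \<mu> H (subgroup_metric G H (T H))"
    and sub: "\<And>H. H \<in> \<H> \<Longrightarrow> subgroup H G"
    and fin: "finite \<F>" and \<F>: "\<And>C. C \<in> \<F> \<Longrightarrow> \<exists>g\<in>carrier G. \<exists>H\<in>\<H>. C = g <# H"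
    and close: "pairwise (close G S D) \<F>"
  shows "\<exists>x\<in>carrier G. \<forall>C\<in>\<F>. word_ball G S (stable_subspace.helly_radius \<mu> K D) x \<inter> C \<noteq> {}"
proof (cases "\<F> = {}")
  case False
  then obtain A where A: "A \<in> \<F>" by blast
  obtain g H where gH: "g \<in> carrier G" "H \<in> \<H>" "A = g <# H" using \<F>[OF A] by blast
  interpret G: Metric_space "carrier G" word_metric by (rule Metric_space_word_metric)
  have coset: "\<exists>dC. stably_embedded (carrier G) word_metric K \<mu> C dC" if "C \<in> \<F>" for C
    using \<F>[OF that] coset_stably_embedded[OF stab] by metis
  have C: "morse (carrier G) word_metric \<mu> C" "C \<subseteq> carrier G" "C \<noteq> {}" if "C \<in> \<F>" for C
  proof -
    show "morse (carrier G) word_metric \<mu> C" using coset[OF that] G.stably_embedded_imp_morse by blast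
    then show "C \<subseteq> carrier G" unfolding morse_def by blast
    show "C \<noteq> {}" using \<F>[OF that] subgroup.one_closed[OF sub] unfolding l_coset_def by blast
  qed
  let ?dA = "coset_metric G H (T H) g"
  have stA: "stably_embedded (carrier G) word_metric K \<mu> A ?dA"
    unfolding gH(3) by (rule coset_stably_embedded[OF stab[OF gH(2)] gH(1)])
  interpret stable_subspace "carrier G" word_metric A ?dA \<mu> K D
  proof (intro stable_subspace.intro stable_subspace_axioms.intro)
    show "Metric_space A ?dA" using stA unfolding stably_embedded_def by blast
  qed (use Metric_space_word_metric discretely_geodesic_word_metric stA K D in auto)
  have pair: "\<exists>b\<in>B. near word_metric D C b" if "B \<in> \<F>" "C \<in> \<F>" for B C
  proof (cases "B = C")
    case True
    then show ?thesis using C[OF that(2)] G.near_self[OF _ _ D] by blast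
  next
    case False
    then have "close G S D B C" using close that unfolding pairwise_def by blast
    then show ?thesis by (rule close_imp_near[OF C(2,3)[OF that(1)] C(2,3)[OF that(2)]])
  qed
  have "\<exists>x\<in>A. \<forall>C\<in>\<F>. near word_metric helly_radius C x"
    by (rule coarse_helly[OF fin C(3)[OF A] C(1) pair[OF A] pair])
  then obtain x where x: "x \<in> A" "\<And>C. C \<in> \<F> \<Longrightarrow> near word_metric helly_radius C x" by blast
  have "word_ball G S helly_radius x \<inter> C \<noteq> {}" if "C \<in> \<F>" for C
  proof -
    obtain c where "c \<in> C" "word_metric x c \<le> helly_radius" using x(2)[OF \<open>C \<in> \<F>\<close>] unfolding near_def by blast
    moreover have "x \<in> carrier G" "c \<in> carrier G" using calculation x C(2)[OF A] C(2)[OF \<open>C \<in> \<F>\<close>] by auto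
    ultimately show ?thesis unfolding word_ball_def restricted_dist_def by auto
  qed
  then show ?thesis using x C(2)[OF A] by blast
qed auto

text \<open>
  The radius for finite families is uniform, so their members all meet one ball of that radius; this
  bounds the size of finite subfamilies and shows that the whole collection is finite.
\<close>
lemma pairwise_close_common_ball:
  assumes K: "K \<ge> 1" and D: "D \<ge> 0" and fin: "finite \<H>"
    and stab: "\<And>H. H \<in> \<H> \<Longrightarrow> stably_embedded (carrier G) word_metric K \<mu> H (subgroup_metric G H (T H))"
    and sub: "\<And>H. H \<in> \<H> \<Longrightarrow> subgroup H G"
    and \<C>: "\<And>C. C \<in> \<C> \<Longrightarrow> \<exists>g\<in>carrier G. \<exists>H\<in>\<H>. C = g <# H"
    and close: "pairwise (close G S D) \<C>"
  shows "\<exists>x\<in>carrier G. \<forall>C\<in>\<C>. word_ball G S (stable_subspace.helly_radius \<mu> K D) x \<inter> C \<noteq> {}"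
proof -
  let ?R = "stable_subspace.helly_radius \<mu> K D"
  let ?N = "card ({g \<in> carrier G. real (word_length G S g) \<le> ?R} \<times> \<H>)"
  have fam: "\<exists>x\<in>carrier G. \<forall>C\<in>\<F>. word_ball G S ?R x \<inter> C \<noteq> {}" if "finite \<F>" "\<F> \<subseteq> \<C>" for \<F>
  proof (rule finite_family_common_ball[OF K D stab sub that(1)])
    show "\<exists>g\<in>carrier G. \<exists>H\<in>\<H>. C = g <# H" if "C \<in> \<F>" for C using \<C> \<open>\<F> \<subseteq> \<C>\<close> that by blast
    show "pairwise (close G S D) \<F>" using pairwise_subset[OF close that(2)] .
  qed
  have "finite \<C>"
  proof (rule ccontr)
    assume "infinite \<C>"
    then obtain \<F> where \<F>: "finite \<F>" "card \<F> = Suc ?N" "\<F> \<subseteq> \<C>"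
      using infinite_arbitrarily_large by blast
    obtain x where x: "x \<in> carrier G" "\<forall>C\<in>\<F>. word_ball G S ?R x \<inter> C \<noteq> {}" using fam \<F> by blast
    have "finite \<F> \<and> card \<F> \<le> ?N"
    proof (rule card_cosets_meeting_ball[OF fin sub x(1)])
      show "\<exists>g\<in>carrier G. \<exists>H\<in>\<H>. C = g <# H" if "C \<in> \<F>" for C using \<C> \<F>(3) that by blast
      show "word_ball G S ?R x \<inter> C \<noteq> {}" if "C \<in> \<F>" for C using x(2) that by blast
    qed
    then show False using \<F>(2) by simp
  qed
  then show ?thesis using fam by blast
qed

end

theorem proposition6p3:
  fixes G :: "('a, 'b) monoid_scheme" and S :: "'a set"
    and \<H> :: "'a set set" and D :: real
  assumes "group G" and "finite_generating_set G S"
    and "finite \<H>" and "\<And>H. H \<in> \<H> \<Longrightarrow> stable_subgroup G S H"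
    and "D \<ge> 0"
  shows "\<exists>R\<ge>0. \<forall>\<C> :: 'a set set.
           (\<forall>C\<in>\<C>. \<exists>g\<in>carrier G. \<exists>H\<in>\<H>. C = g <#\<^bsub>G\<^esub> H) \<and> pairwise (close G S D) \<C> \<longrightarrow>
           (\<exists>x\<in>carrier G. \<forall>C\<in>\<C>. word_ball G S R x \<inter> C \<noteq> {})"
proof -
  interpret generated_group G S
    using assms by (intro generated_group.intro generated_group_axioms.intro)
  obtain K \<mu> T where K: "K \<ge> 1"
    and stab: "\<And>H. H \<in> \<H> \<Longrightarrow> stably_embedded (carrier G) word_metric K \<mu> H (subgroup_metric G H (T H))"
    using uniform_stably_embedded[OF assms(3,4)] by metis
  have sub: "\<And>H. H \<in> \<H> \<Longrightarrow> subgroup H G" using assms(4) unfolding stable_subgroup_def by blast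
  let ?R = "max 0 (stable_subspace.helly_radius \<mu> K D)"
  have ball: "word_ball G S (stable_subspace.helly_radius \<mu> K D) x \<subseteq> word_ball G S ?R x" for x
    unfolding word_ball_def by auto
  show ?thesis
  proof (intro exI[of _ ?R] conjI allI impI)
    fix \<C> :: "'a set set"
    assume "(\<forall>C\<in>\<C>. \<exists>g\<in>carrier G. \<exists>H\<in>\<H>. C = g <#\<^bsub>G\<^esub> H) \<and> pairwise (close G S D) \<C>"
    then have cosets: "\<And>C. C \<in> \<C> \<Longrightarrow> \<exists>g\<in>carrier G. \<exists>H\<in>\<H>. C = g <#\<^bsub>G\<^esub> H"
      and close: "pairwise (close G S D) \<C>"
      by blast+
    have "\<exists>x\<in>carrier G. \<forall>C\<in>\<C>. word_ball G S (stable_subspace.helly_radius \<mu> K D) x \<inter> C \<noteq> {}"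
      by (rule pairwise_close_common_ball[OF K assms(5,3) stab sub cosets close])
    then obtain x where "x \<in> carrier G" "\<forall>C\<in>\<C>. word_ball G S (stable_subspace.helly_radius \<mu> K D) x \<inter> C \<noteq> {}"
      by blast
    then show "\<exists>x\<in>carrier G. \<forall>C\<in>\<C>. word_ball G S ?R x \<inter> C \<noteq> {}" using ball by blast
  qed simp
qed

end
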